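(* Let $x_1,x_2,s,t,u,\lambda\in\mathbb{C}$ with $\operatorname{Re}(2\lambda-s+t+u)>0$. For integers $k\ge 0$ put $$\varepsilon_k=\frac{(\lambda-x_1)(\lambda-x_2)}{\lambda+k},\qquad c_k^\pm=\frac{s+k}{2}\pm\sqrt{\frac{(s+k)^2}{4}+\lambda(x_1+x_2-s-k)-x_1x_2}.$$ Assume that $x_1$, $x_2$, $s-x_1-x_2$ and $\lambda$ are not non-positive integers and that, for every integer $k\ge0$, none of the numbers $\lambda-\varepsilon_k$, $s-\lambda+\varepsilon_k+k$, $c_k^+$, $c_k^-$ is a non-positive integer. Then $$\begin{aligned} &\frac{\Gamma(x_1)\Gamma(x_2)\Gamma(s-x_1-x_2)}{\Gamma(t-x_1)\Gamma(t-x_2)\Gamma(u+x_1+x_2)}\\ &\quad=\sum_{k=0}^\infty\frac{(-1)^k}{k!}\,\frac{\Gamma(\lambda-\varepsilon_k)\,\Gamma(s-\lambda+\varepsilon_k+k)}{\Gamma(t+k)\,\Gamma(t-\lambda+\varepsilon_k)\,\Gamma(u+\lambda-\varepsilon_k-k)}\left(\frac{1}{x_1+k}+\frac{1}{x_2+k}-\frac{1}{\lambda+k}\right)\\ &\qquad+\sum_{k=0}^\infty\frac{(-1)^k}{k!}\,\frac{\Gamma(c_k^+)\,\Gamma(c_k^-)}{\Gamma(t-c_k^+)\,\Gamma(t-c_k^-)\,\Gamma(u+s+k)}\cdot\frac{1}{s+k-x_1-x_2}. \end{aligned}$$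
   Context: The reciprocal gamma function $1/\Gamma$ is understood as an entire function (equal to $0$ at the non-positive integers). The choice of square root in $c_k^\pm$ is immaterial, since the expressions are symmetric in $c_k^+$ and $c_k^-$. *)

theory Defs
  imports "HOL-Analysis.Analysis"
begin

definition eps :: "complex \<Rightarrow> complex \<Rightarrow> complex \<Rightarrow> nat \<Rightarrow> complex" where
  "eps x1 x2 l k = (l - x1) * (l - x2) / (l + of_nat k)"

definition c_disc :: "complex \<Rightarrow> complex \<Rightarrow> complex \<Rightarrow> complex \<Rightarrow> nat \<Rightarrow> complex" where
  "c_disc x1 x2 s l k =
     (s + of_nat k)\<^sup>2 / 4 + l * (x1 + x2 - s - of_nat k) - x1 * x2"

(* The principal square root is used; another choice of root only exchanges c_plus and c_minus. *)
definition c_plus :: "complex \<Rightarrow> complex \<Rightarrow> complex \<Rightarrow> complex \<Rightarrow> nat \<Rightarrow> complex" where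
  "c_plus x1 x2 s l k = (s + of_nat k) / 2 + csqrt (c_disc x1 x2 s l k)"

definition c_minus :: "complex \<Rightarrow> complex \<Rightarrow> complex \<Rightarrow> complex \<Rightarrow> nat \<Rightarrow> complex" where
  "c_minus x1 x2 s l k = (s + of_nat k) / 2 - csqrt (c_disc x1 x2 s l k)"

(* In both summands the entire function rGamma stands for the factors 1 / Gamma. *)
definition term1 ::
  "complex \<Rightarrow> complex \<Rightarrow> complex \<Rightarrow> complex \<Rightarrow> complex \<Rightarrow> complex \<Rightarrow> nat \<Rightarrow> complex" where
  "term1 x1 x2 s t u l k =
     (-1) ^ k / fact k
     * (Gamma (l - eps x1 x2 l k) * Gamma (s - l + eps x1 x2 l k + of_nat k))
     * (rGamma (t + of_nat k) * rGamma (t - l + eps x1 x2 l k)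
        * rGamma (u + l - eps x1 x2 l k - of_nat k))
     * (1 / (x1 + of_nat k) + 1 / (x2 + of_nat k) - 1 / (l + of_nat k))"

definition term2 ::
  "complex \<Rightarrow> complex \<Rightarrow> complex \<Rightarrow> complex \<Rightarrow> complex \<Rightarrow> complex \<Rightarrow> nat \<Rightarrow> complex" where
  "term2 x1 x2 s t u l k =
     (-1) ^ k / fact k
     * (Gamma (c_plus x1 x2 s l k) * Gamma (c_minus x1 x2 s l k))
     * (rGamma (t - c_plus x1 x2 s l k) * rGamma (t - c_minus x1 x2 s l k)
        * rGamma (u + s + of_nat k))
     * (1 / (s + of_nat k - x1 - x2))"

end

theory Submission
  imports Defs "HOL-Complex_Analysis.Complex_Analysis"
begin

text \<open>
Both sides are pieces of one residue computation. Write \<open>\<lambda>\<close> for the variable \<open>l\<close>. Put \<open>C = (\<lambda> - x\<^sub>1)(\<lambda> - x\<^sub>2)\<close> and move the pair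
\<open>(x\<^sub>1, x\<^sub>2)\<close> along the curve \<open>(\<lambda> - X\<^sub>1)(\<lambda> - X\<^sub>2) = C\<close>, with parameter
\<open>w = a + b\<close> where \<open>a = \<lambda> - X\<^sub>1\<close> and \<open>b = \<lambda> - X\<^sub>2\<close>. The numbers \<open>a\<close> and \<open>b\<close> are
the roots of \<open>z\<^sup>2 - w z + C\<close>, and the left-hand side of the identity is symmetric in them, so along
the curve it becomes a meromorphic function \<open>G\<close> of the single variable \<open>w\<close>; the given pair
corresponds to \<open>w = w0 = 2\<lambda> - x\<^sub>1 - x\<^sub>2\<close>.

The product \<open>\<Gamma>(X\<^sub>1) \<Gamma>(X\<^sub>2)\<close> has a pole when one coordinate equals
\<open>-k\<close>; the other one is then \<open>\<lambda> - \<epsilon>\<^sub>k\<close>, and \<open>w = W k = \<lambda> + k + \<epsilon>\<^sub>k\<close>. The factor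
\<open>\<Gamma>(s - X\<^sub>1 - X\<^sub>2)\<close> has a pole at \<open>w = V k = 2\<lambda> - s - k\<close>, where the coordinates are
\<open>c\<^sub>k\<^sup>+\<close> and \<open>c\<^sub>k\<^sup>-\<close>. The hypotheses keep all these points apart from each
other and from \<open>w0\<close>, so each of them is at most a simple pole. Hence \<open>H w = G w / (w - w0)\<close> has at \<open>w0\<close> the left-hand side as its residue, while its
residues at \<open>W k\<close> and \<open>V k\<close> are minus the summands of the two series (lemmas \<open>residue_w0\<close>,
\<open>residue_W\<close>, \<open>residue_V\<close>), and the theorem says that the residues of \<open>H\<close> add up to zero.

For large \<open>w\<close> one root is close to \<open>w\<close> and the other one, \<open>b\<close>, is of size \<open>1 / w\<close>. So \<open>G w\<close>
behaves like \<open>\<Gamma>(\<lambda> - w) \<Gamma>(s - 2\<lambda> + w) / (\<Gamma>(t - \<lambda> + w) \<Gamma>(u + 2\<lambda> - w))\<close>,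
which away from its poles is of order \<open>\<bar>w\<bar>\<^sup>-\<^sup>\<delta>\<close> with \<open>\<delta> = Re (2\<lambda> - s + t + u) > 0\<close>; the
perturbation by \<open>b\<close> costs an arbitrarily small power, and half of the exponent is given away to it.
The resulting bound \<open>\<bar>H w\<bar> \<le> K \<bar>w\<bar>\<^sup>-\<^sup>1\<^sup>-\<^sup>\<delta>\<^sup>/\<^sup>2\<close> (lemma \<open>norm_H_le\<close>) is used twice. On circles of fixed radius
around the poles it bounds the residues and shows that both series converge absolutely. On rectangles
whose vertical sides run half-way between consecutive poles it shows that the contour integrals tend to
zero, so the sum of all residues vanishes (lemma \<open>sum_residues_zero\<close>).

The bound itself rests on the estimate \<open>\<bar>\<Gamma>(z + \<alpha>) / \<Gamma>(z + \<beta>)\<bar> \<le> K \<bar>z\<bar>\<^sup>Re\<^sup>(\<alpha>\<^sup>-\<^sup>\<beta>\<^sup>)\<close>, uniform for bounded \<open>\<alpha>\<close>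
and \<open>\<beta>\<close> (lemma \<open>norm_Gamma_mult_rGamma_le\<close>). Uniformity is essential, because the root \<open>b\<close>, which
enters the shifts, depends on \<open>w\<close>.
\<close>

section \<open>Growth of quotients of Gamma functions\<close>
lemma norm_Ln_plus_1_minus_Ln_le:
  assumes "Re z > 0"
  shows "norm (Ln (z + 1) - Ln z - 1 / z) \<le> 1 / (norm z)\<^sup>2"
proof -
  have z0: "z \<noteq> 0" using assms by auto
  have seg: "\<exists>t. 0 \<le> t \<and> x = z + of_real t \<and> t \<le> 1" if "x \<in> closed_segment z (z + 1)" for x
    using that by (auto simp: closed_segment_def algebra_simps scaleR_conv_of_real)
  have "norm ((Ln (z + 1) - (z + 1) / z) - (Ln z - z / z)) \<le> 1 / (norm z)\<^sup>2 * norm ((z + 1) - z)"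
  proof (rule field_differentiable_bound[where S = "closed_segment z (z + 1)"
        and f = "\<lambda>x. Ln x - x / z" and f' = "\<lambda>x. 1 / x - 1 / z"])
    fix x assume "x \<in> closed_segment z (z + 1)"
    then obtain t where t: "0 \<le> t" "x = z + of_real t" "t \<le> 1" using seg by blast
    have x: "Re x > 0" using assms t by auto
    then have "x \<notin> \<real>\<^sub>\<le>\<^sub>0" by (auto simp: complex_nonpos_Reals_iff)
    then show "((\<lambda>x. Ln x - x / z) has_field_derivative 1 / x - 1 / z)
        (at x within closed_segment z (z + 1))"
      using z0 by (auto intro!: derivative_eq_intros simp: field_simps)
    have "\<bar>Re z\<bar> \<le> \<bar>Re x\<bar>" "\<bar>Im z\<bar> \<le> \<bar>Im x\<bar>" using t assms by auto
    then have le: "norm z \<le> norm x" 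
      by (auto simp: cmod_def real_sqrt_le_iff intro!: add_mono abs_le_square_iff[THEN iffD1])
    have x0: "x \<noteq> 0" using x by auto
    have "1 / x - 1 / z = - of_real t / (x * z)" using t z0 x0 by (simp add: field_simps)
    then have "norm (1 / x - 1 / z) = t / (norm x * norm z)" using t 
      by (simp add: norm_divide norm_mult)
    also have "\<dots> \<le> 1 / (norm z * norm z)"
      using t z0 x0 le by (intro frac_le mult_right_mono) auto
    finally show "norm (1 / x - 1 / z) \<le> 1 / (norm z)\<^sup>2" by (simp add: power2_eq_square)
  qed auto
  moreover have "(Ln (z + 1) - (z + 1) / z) - (Ln z - z / z) = Ln (z + 1) - Ln z - 1 / z"
    using z0 by (simp add: field_simps)
  ultimately show ?thesis by (simp only: add_diff_cancel_left' norm_one mult_1_right)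
qed

text \<open>
\<open>Digamma z\<close> is the limit of \<open>ln m - (\<Sum>n<m. 1 / (z + n))\<close>. Telescoping \<open>Ln (z + m) - Ln z\<close> turns
\<open>Digamma z - Ln z\<close> into a series of second-order errors \<open>O(1 / \<bar>z + n\<bar>\<^sup>2)\<close>, and \<open>\<bar>z + n\<bar> \<ge> n + 1\<close>.
This crude form of Stirling's formula suffices, because a bounded error in the logarithmic derivative
changes a quotient of Gamma values at bounded distance by a bounded factor only.
\<close>
lemma Digamma_minus_Ln_bounded:
  obtains K where "K \<ge> 0" "\<And>z. Re z \<ge> 1 \<Longrightarrow> norm (Digamma z - Ln z) \<le> K"
proof
  have sm: "summable (\<lambda>n. 1 / (real n + 1)\<^sup>2)"
    using inverse_squares_sums by (simp add: sums_iff add_ac)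
  let ?K = "(\<Sum>n. 1 / (real n + 1)\<^sup>2)"
  show "?K \<ge> 0" by (intro suminf_nonneg sm) auto
  fix z :: complex assume z: "Re z \<ge> 1"
  have z0: "z \<noteq> 0" using z by auto
  have "(\<lambda>m. Ln (1 + z / of_nat m)) \<longlonglongrightarrow> Ln (1 + 0)"
    by (intro tendsto_intros lim_const_over_n) auto
  moreover have "eventually (\<lambda>m. Ln (1 + z / of_nat m) = Ln (z + of_nat m) - of_real (ln (real m))) sequentially"
  proof (use eventually_gt_at_top[of 0] in eventually_elim)
    fix m :: nat assume m: "m > 0"
    have "1 + z / of_nat m = (z + of_nat m) / of_real (real m)" using m by (simp add: field_simps)
    moreover have "z + of_nat m \<noteq> 0" using z by (auto simp: complex_eq_iff)
    ultimately show "Ln (1 + z / of_nat m) = Ln (z + of_nat m) - of_real (ln (real m))"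
      using m by (simp add: Ln_divide_of_real del: of_real_of_nat_eq)
  qed
  ultimately have "(\<lambda>m. Ln (z + of_nat m) - of_real (ln (real m))) \<longlonglongrightarrow> 0"
    by (simp add: tendsto_cong)
  from tendsto_add[OF Digamma_LIMSEQ[OF z0] this]
  have "(\<lambda>m. Ln (z + of_nat m) - (\<Sum>n<m. inverse (z + of_nat n)) - Ln z) \<longlonglongrightarrow> Digamma z - Ln z"
    by (intro tendsto_diff) (simp_all add: algebra_simps)
  moreover have "norm (Ln (z + of_nat m) - (\<Sum>n<m. inverse (z + of_nat n)) - Ln z) \<le> ?K" for m
  proof -
    have "Ln (z + of_nat m) - (\<Sum>n<m. inverse (z + of_nat n)) - Ln z
        = (\<Sum>n<m. Ln (z + of_nat n + 1) - Ln (z + of_nat n) - 1 / (z + of_nat n))"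
      by (induction m) (simp_all add: field_simps inverse_eq_divide)
    also have "norm \<dots> \<le> (\<Sum>n<m. 1 / (real n + 1)\<^sup>2)"
    proof (intro sum_norm_le)
      fix n :: nat
      have re: "Re (z + of_nat n) \<ge> real n + 1" using z by simp
      then have "norm (z + of_nat n) \<ge> real n + 1" using complex_Re_le_cmod order_trans by blast
      then have "1 / (norm (z + of_nat n))\<^sup>2 \<le> 1 / (real n + 1)\<^sup>2"
        by (intro divide_left_mono power_mono) (auto simp: zero_less_mult_iff intro!: mult_pos_pos)
      then show "norm (Ln (z + of_nat n + 1) - Ln (z + of_nat n) - 1 / (z + of_nat n)) \<le> 1 / (real n + 1)\<^sup>2"
        using norm_Ln_plus_1_minus_Ln_le[of "z + of_nat n"] re by auto
    qed
    also have "\<dots> \<le> ?K" by (intro sum_le_suminf sm) auto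
    finally show ?thesis .
  qed
  ultimately show "norm (Digamma z - Ln z) \<le> ?K"
    by (intro Lim_norm_ubound[of sequentially]) auto
qed

lemma norm_exp_mult_Ln_le:
  assumes "z \<noteq> 0"
  shows "norm (exp (c * Ln z)) \<le> exp (pi * norm c) * norm z powr Re c"
proof -
  have "\<bar>Im c * Im (Ln z)\<bar> \<le> norm c * pi"
    unfolding abs_mult using mpi_less_Im_Ln[OF assms] Im_Ln_le_pi[OF assms] abs_Im_le_cmod[of c]
    by (intro mult_mono) auto
  then have "Re c * ln (norm z) - Im c * Im (Ln z) \<le> pi * norm c + Re c * ln (norm z)"
    by (simp add: mult.commute)
  then show ?thesis using assms by (simp add: powr_def flip: exp_add)
qed

text \<open>
The function \<open>ln_Gamma x - x Ln z\<close> has derivative \<open>Digamma x - Ln z\<close>, which is bounded on the disc of radius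
\<open>M\<close> around \<open>z\<close>. So \<open>\<Gamma>(z + \<alpha>) / \<Gamma>(z + \<beta>)\<close> differs from \<open>exp ((\<alpha> - \<beta>) Ln z)\<close> by a bounded factor.
\<close>
lemma norm_Gamma_mult_rGamma_le_far_right:
  assumes "M \<ge> 0"
  obtains K where "K \<ge> 0"
    "\<And>z \<alpha> \<beta>. \<lbrakk>Re z \<ge> M + 1; norm \<alpha> \<le> M; norm \<beta> \<le> M\<rbrakk>
       \<Longrightarrow> norm (Gamma (z + \<alpha>) * rGamma (z + \<beta>)) \<le> K * norm z powr Re (\<alpha> - \<beta>)"
proof -
  obtain D where D: "D \<ge> 0" "\<And>z. Re z \<ge> 1 \<Longrightarrow> norm (Digamma z - Ln z) \<le> D"
    using Digamma_minus_Ln_bounded by blast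
  let ?K = "exp ((D + M) * (2 * M)) * exp (pi * (2 * M))"
  show ?thesis
  proof
    show "?K \<ge> 0" by simp
    fix z \<alpha> \<beta> :: complex
    assume z: "Re z \<ge> M + 1" and \<alpha>: "norm \<alpha> \<le> M" and \<beta>: "norm \<beta> \<le> M"
    let ?B = "cball z M"
    have re: "Re x \<ge> 1" if "x \<in> ?B" for x
      using that z abs_Re_le_cmod[of "z - x"] by (auto simp: dist_norm)
    have nr: "x \<notin> \<real>\<^sub>\<le>\<^sub>0" if "x \<in> ?B" for x
      using re[OF that] by (auto simp: complex_nonpos_Reals_iff)
    have ni: "x \<notin> \<int>\<^sub>\<le>\<^sub>0" if "x \<in> ?B" for x
      using nr[OF that] nonpos_Ints_subset_nonpos_Reals by blast
    have Lnd: "norm (Ln x - Ln z) \<le> M" if "x \<in> ?B" for x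
    proof -
      have "norm (Ln x - Ln z) \<le> 1 * norm (x - z)"
      proof (rule field_differentiable_bound[where S = ?B and f' = "\<lambda>x. 1 / x"])
        fix y assume y: "y \<in> ?B"
        show "(Ln has_field_derivative 1 / y) (at y within ?B)"
          using has_field_derivative_Ln[OF nr[OF y]]
          by (simp add: inverse_eq_divide has_field_derivative_at_within)
        have "1 \<le> norm y" using re[OF y] complex_Re_le_cmod order_trans by blast
        then show "norm (1 / y) \<le> 1" by (simp add: norm_divide divide_le_eq_1)
      qed (use that assms in auto)
      also have "\<dots> \<le> M" using that by (simp add: dist_norm norm_minus_commute)
      finally show ?thesis .
    qed
    have zB: "z + \<alpha> \<in> ?B" "z + \<beta> \<in> ?B" using \<alpha> \<beta> by (auto simp: dist_norm)
    have eq: "(ln_Gamma (z + \<alpha>) - (z + \<alpha>) * Ln z) - (ln_Gamma (z + \<beta>) - (z + \<beta>) * Ln z)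
      = ln_Gamma (z + \<alpha>) - ln_Gamma (z + \<beta>) - (\<alpha> - \<beta>) * Ln z"
      by (simp add: algebra_simps)
    have "norm ((ln_Gamma (z + \<alpha>) - (z + \<alpha>) * Ln z) - (ln_Gamma (z + \<beta>) - (z + \<beta>) * Ln z))
      \<le> (D + M) * norm ((z + \<alpha>) - (z + \<beta>))"
    proof (rule field_differentiable_bound[where S = ?B and f' = "\<lambda>x. Digamma x - Ln z"
           and f = "\<lambda>x. ln_Gamma x - x * Ln z"])
      fix y assume y: "y \<in> ?B"
      show "((\<lambda>x. ln_Gamma x - x * Ln z) has_field_derivative Digamma y - Ln z) (at y within ?B)"
        by (rule has_field_derivative_at_within) (use nr[OF y] in \<open>auto intro!: derivative_eq_intros\<close>)
      have "Digamma y - Ln z = (Digamma y - Ln y) + (Ln y - Ln z)" by simp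
      then show "norm (Digamma y - Ln z) \<le> D + M"
        using norm_triangle_mono[OF D(2)[OF re[OF y]] Lnd[OF y]] by simp
    qed (use zB in auto)
    also have "\<dots> \<le> (D + M) * (2 * M)"
      using norm_triangle_ineq4[of \<alpha> \<beta>] \<alpha> \<beta> D(1) assms by (intro mult_left_mono) auto
    finally have b: "norm (ln_Gamma (z + \<alpha>) - ln_Gamma (z + \<beta>) - (\<alpha> - \<beta>) * Ln z) \<le> (D + M) * (2 * M)"
      by (subst (asm) eq)
    let ?e = "ln_Gamma (z + \<alpha>) - ln_Gamma (z + \<beta>) - (\<alpha> - \<beta>) * Ln z"
    have "Gamma (z + \<alpha>) * rGamma (z + \<beta>) = exp ?e * exp ((\<alpha> - \<beta>) * Ln z)"
      using ni[OF zB(1)] ni[OF zB(2)]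
      by (simp add: Gamma_complex_altdef rGamma_complex_altdef flip: exp_add)
    also have "norm \<dots> \<le> exp ((D + M) * (2 * M)) * (exp (pi * (2 * M)) * norm z powr Re (\<alpha> - \<beta>))"
      unfolding norm_mult
    proof (intro mult_mono)
      show "norm (exp ?e) \<le> exp ((D + M) * (2 * M))"
        using complex_Re_le_cmod[of ?e] b by (simp only: norm_exp_eq_Re exp_le_cancel_iff)
      have "norm (exp ((\<alpha> - \<beta>) * Ln z)) \<le> exp (pi * norm (\<alpha> - \<beta>)) * norm z powr Re (\<alpha> - \<beta>)"
        using z assms by (intro norm_exp_mult_Ln_le) auto
      also have "\<dots> \<le> exp (pi * (2 * M)) * norm z powr Re (\<alpha> - \<beta>)"
        using norm_triangle_ineq4[of \<alpha> \<beta>] \<alpha> \<beta> by (intro mult_right_mono) auto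
      finally show "norm (exp ((\<alpha> - \<beta>) * Ln z)) \<le> exp (pi * (2 * M)) * norm z powr Re (\<alpha> - \<beta>)" .
    qed auto
    finally show "norm (Gamma (z + \<alpha>) * rGamma (z + \<beta>)) \<le> ?K * norm z powr Re (\<alpha> - \<beta>)" by simp
  qed
qed

text \<open>
A shift by an integer \<open>m > M\<close> leads back to the previous case. The Pochhammer factors that appear are
products of \<open>m\<close> factors of size comparable to \<open>\<bar>z\<bar>\<close>, so their quotient is bounded.
\<close>
lemma norm_Gamma_mult_rGamma_le_right:
  assumes "M \<ge> 0"
  obtains K R where "K \<ge> 0" "R > 0"
    "\<And>z \<alpha> \<beta>. \<lbrakk>Re z \<ge> 0; norm z \<ge> R; norm \<alpha> \<le> M; norm \<beta> \<le> M\<rbrakk>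
       \<Longrightarrow> norm (Gamma (z + \<alpha>) * rGamma (z + \<beta>)) \<le> K * norm z powr Re (\<alpha> - \<beta>)"
proof -
  obtain K where K: "K \<ge> 0"
    "\<And>z \<alpha> \<beta>. \<lbrakk>Re z \<ge> M + 1; norm \<alpha> \<le> M; norm \<beta> \<le> M\<rbrakk>
       \<Longrightarrow> norm (Gamma (z + \<alpha>) * rGamma (z + \<beta>)) \<le> K * norm z powr Re (\<alpha> - \<beta>)"
    using norm_Gamma_mult_rGamma_le_far_right[OF assms] by blast
  define m where "m = nat \<lceil>M + 1\<rceil>"
  have m: "real m \<ge> M + 1" unfolding m_def by linarith
  let ?R = "2 * (M + real m)" and ?K = "3 ^ m * (K * 2 powr (2 * M))"
  show ?thesis
  proof
    show "?K \<ge> 0" using K by simp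
    show "?R > 0" using m assms by simp
    fix z \<alpha> \<beta> :: complex
    assume z: "Re z \<ge> 0" "norm z \<ge> ?R" and \<alpha>: "norm \<alpha> \<le> M" and \<beta>: "norm \<beta> \<le> M"
    have z0: "norm z > 0" using \<open>?R > 0\<close> z by linarith
    let ?z = "z + of_nat m"
    have lower: "norm (z + \<gamma> + of_nat i) \<ge> norm z / 2" if "norm \<gamma> \<le> M" "i < m" for \<gamma> i
    proof -
      have "norm z \<le> norm (z + \<gamma> + of_nat i) + norm (\<gamma> + of_nat i)"
        using norm_triangle_ineq4[of "z + \<gamma> + of_nat i" "\<gamma> + of_nat i"] by simp
      moreover have "norm (\<gamma> + of_nat i) \<le> M + real m"
        using that norm_triangle_ineq[of \<gamma> "of_nat i"] by simp
      ultimately show ?thesis using z by simp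
    qed
    have upper: "norm (z + \<gamma> + of_nat i) \<le> 3 / 2 * norm z" if "norm \<gamma> \<le> M" "i < m" for \<gamma> i
    proof -
      have "norm (z + \<gamma> + of_nat i) \<le> norm z + norm (\<gamma> + of_nat i)"
        using norm_triangle_ineq[of z "\<gamma> + of_nat i"] by (simp add: add_ac)
      moreover have "norm (\<gamma> + of_nat i) \<le> M + real m"
        using that norm_triangle_ineq[of \<gamma> "of_nat i"] by simp
      ultimately show ?thesis using z by simp
    qed
    have poch: "norm (pochhammer (z + \<beta>) m / pochhammer (z + \<alpha>) m) \<le> 3 ^ m"
    proof -
      have "norm (pochhammer (z + \<beta>) m / pochhammer (z + \<alpha>) m)
        = (\<Prod>i<m. norm (z + \<beta> + of_nat i) / norm (z + \<alpha> + of_nat i))"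
        by (simp add: pochhammer_prod norm_divide prod_dividef prod_norm lessThan_atLeast0)
      also have "\<dots> \<le> (\<Prod>i<m. 3)"
      proof (intro prod_mono conjI)
        fix i assume "i \<in> {..<m}"
        then have i: "i < m" by simp
        have "norm (z + \<beta> + of_nat i) \<le> 3 * (norm z / 2)" using upper[OF \<beta> i] by simp
        also have "\<dots> \<le> 3 * norm (z + \<alpha> + of_nat i)" using lower[OF \<alpha> i] by simp
        finally show "norm (z + \<beta> + of_nat i) / norm (z + \<alpha> + of_nat i) \<le> 3"
          using lower[OF \<alpha> i] z0 by (subst pos_divide_le_eq) auto
      qed auto
      finally show ?thesis by simp
    qed
    have z': "norm z \<le> norm ?z" "norm ?z \<le> 2 * norm z"
    proof -
      show "norm z \<le> norm ?z"
        using z(1) unfolding cmod_def by (auto intro!: real_sqrt_le_mono power_mono)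
      show "norm ?z \<le> 2 * norm z"
        using norm_triangle_ineq[of z "of_nat m"] z(2) assms by simp
    qed
    have pw: "norm ?z powr Re (\<alpha> - \<beta>) \<le> 2 powr (2 * M) * norm z powr Re (\<alpha> - \<beta>)"
    proof -
      have le: "\<bar>Re (\<alpha> - \<beta>)\<bar> \<le> 2 * M"
        using abs_Re_le_cmod[of "\<alpha> - \<beta>"] norm_triangle_ineq4[of \<alpha> \<beta>] \<alpha> \<beta> by linarith
      let ?q = "norm ?z / norm z"
      have q: "1 \<le> ?q" "?q \<le> 2" using z' z0 by (simp_all add: divide_simps)
      have "?q powr Re (\<alpha> - \<beta>) \<le> ?q powr (2 * M)" using q le by (intro powr_mono) auto
      also have "\<dots> \<le> 2 powr (2 * M)" using q assms by (intro powr_mono2) auto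
      finally have "?q powr Re (\<alpha> - \<beta>) * norm z powr Re (\<alpha> - \<beta>) \<le> 2 powr (2 * M) * norm z powr Re (\<alpha> - \<beta>)"
        by (intro mult_right_mono) auto
      moreover have "?q powr Re (\<alpha> - \<beta>) * norm z powr Re (\<alpha> - \<beta>) = norm ?z powr Re (\<alpha> - \<beta>)"
        using z0 by (simp add: powr_divide)
      ultimately show ?thesis by simp
    qed
    have "Gamma (z + \<alpha>) * rGamma (z + \<beta>)
      = (pochhammer (z + \<beta>) m / pochhammer (z + \<alpha>) m) * (Gamma (?z + \<alpha>) * rGamma (?z + \<beta>))"
      unfolding Gamma_def using pochhammer_rGamma[of "z + \<alpha>" m] pochhammer_rGamma[of "z + \<beta>" m]
      by (simp add: field_simps)
    also have "norm \<dots> \<le> 3 ^ m * (K * (2 powr (2 * M) * norm z powr Re (\<alpha> - \<beta>)))"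
      unfolding norm_mult[of "_ / _"]
    proof (intro mult_mono poch)
      have "norm (Gamma (?z + \<alpha>) * rGamma (?z + \<beta>)) \<le> K * norm ?z powr Re (\<alpha> - \<beta>)"
        using z m \<alpha> \<beta> by (intro K) auto
      also have "\<dots> \<le> K * (2 powr (2 * M) * norm z powr Re (\<alpha> - \<beta>))"
        by (intro mult_left_mono pw K)
      finally show "norm (Gamma (?z + \<alpha>) * rGamma (?z + \<beta>)) \<le> K * (2 powr (2 * M) * norm z powr Re (\<alpha> - \<beta>))" .
    qed auto
    finally show "norm (Gamma (z + \<alpha>) * rGamma (z + \<beta>)) \<le> ?K * norm z powr Re (\<alpha> - \<beta>)"
      by (simp add: mult_ac)
  qed
qed

lemma norm_cos_le_norm_sin_plus_1: "norm (cos z) \<le> norm (sin z) + 1" for z :: complex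
proof -
  have *: "norm (cos w) \<le> norm (sin w) + 1" if "Im w \<ge> 0" for w :: complex
  proof -
    have "cos w = exp (\<i> * w) - \<i> * sin w" by (simp add: exp_Euler)
    also have "norm \<dots> \<le> norm (exp (\<i> * w)) + norm (\<i> * sin w)" by (rule norm_triangle_ineq4)
    also have "\<dots> \<le> norm (sin w) + 1" using that by (simp add: norm_mult)
    finally show ?thesis .
  qed
  show ?thesis using *[of z] *[of "- z"] by (cases "Im z \<ge> 0") auto
qed

text \<open>
By periodicity, \<open>Re z\<close> may be taken in \<open>[0, 1]\<close>. If also \<open>\<bar>Im z\<bar> \<le> 1\<close>, compactness gives the bound; otherwise
\<open>\<bar>sin (\<pi> z)\<bar>\<close> is large because of its exponential growth in the imaginary direction.
\<close>
lemma norm_sin_pi_ge_away_from_Ints: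
  assumes "r > 0"
  obtains c where "c > 0"
    "\<And>z :: complex. (\<And>j. norm (z - of_int j) \<ge> r) \<Longrightarrow> norm (sin (of_real pi * z)) \<ge> c"
proof -
  let ?S = "cbox (Complex (-1) (-1)) (Complex 1 1) \<inter> {z. \<forall>j. norm (z - of_int j) \<ge> r}"
  have S: "?S = cbox (Complex (-1) (-1)) (Complex 1 1) \<inter> (\<Inter>j. {z. norm (z - of_int j) \<ge> r})"
    by auto
  have cl: "compact ?S"
    unfolding S by (intro compact_Int_closed compact_cbox closed_INT ballI closed_Collect_le continuous_intros)
  have cont: "continuous_on ?S (\<lambda>z. norm (sin (of_real pi * z)))" by (intro continuous_intros)
  obtain c where c: "c > 0" "\<And>z. z \<in> ?S \<Longrightarrow> norm (sin (of_real pi * z)) \<ge> c"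
  proof (cases "?S = {}")
    case True
    then show ?thesis using that[of 1] by auto
  next
    case False
    then obtain x where x: "x \<in> ?S" "\<And>z. z \<in> ?S \<Longrightarrow> norm (sin (of_real pi * x)) \<le> norm (sin (of_real pi * z))"
      using continuous_attains_inf[OF cl False cont] by blast
    have "sin (of_real pi * x) \<noteq> 0"
    proof
      assume "sin (of_real pi * x) = 0"
      then obtain j :: int where "of_real pi * x = of_real pi * of_int j"
        by (auto simp: sin_eq_0 mult_ac)
      then have "x = of_int j" by simp
      moreover have "norm (x - of_int j) \<ge> r" using x by auto
      ultimately show False using assms by simp
    qed
    then show ?thesis using that[of "norm (sin (of_real pi * x))"] x by auto
  qed
  show ?thesis
  proof
    show "min c 1 > 0" using c by simp
    fix z :: complex assume far: "\<And>j. norm (z - of_int j) \<ge> r"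
    show "norm (sin (of_real pi * z)) \<ge> min c 1"
    proof (cases "\<bar>Im z\<bar> \<le> 1")
      case True
      define k where "k = \<lfloor>Re z\<rfloor>"
      have "z - of_int k \<in> ?S"
        using True far[of "_ + k"] 
        by (auto simp: in_cbox_complex_iff k_def diff_diff_eq add_ac) linarith+
      from c(2)[OF this] have "norm (sin (of_real pi * (z - of_int k))) \<ge> c" .
      moreover have "norm (sin (of_real pi * (z - of_int k))) = norm (sin (of_real pi * z))"
      proof -
        have s: "sin (of_real pi * of_int k :: complex) = 0" by (auto simp: sin_eq_0 mult_ac)
        have "(cos (of_real pi * of_int k :: complex))\<^sup>2 = 1"
          using sin_cos_squared_add[of "of_real pi * of_int k :: complex"] s by simp
        then have "norm (cos (of_real pi * of_int k :: complex)) = 1"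
          by (metis norm_one norm_power power2_eq_1_iff norm_minus_cancel)
        then show ?thesis by (simp add: right_diff_distrib sin_diff s norm_mult)
      qed
      ultimately show ?thesis by simp
    next
      case False
      let ?y = "pi * Im z"
      have "\<bar>?y\<bar> \<ge> 3" using False pi_gt3 by (auto simp: abs_mult intro: order_trans[of _ "pi * 1"])
      then have "1 + 2 * \<bar>?y\<bar> \<ge> 6" by simp
      then have "exp (2 * \<bar>?y\<bar>) \<ge> 6" using exp_ge_add_one_self[of "2 * \<bar>?y\<bar>"] by linarith
      moreover have "exp (2 * ?y) + inverse (exp (2 * ?y)) \<ge> exp (2 * \<bar>?y\<bar>)"
        by (cases "?y \<ge> 0") (auto simp: exp_minus abs_if)
      ultimately have "exp (2 * ?y) + inverse (exp (2 * ?y)) - 2 * cos (2 * (pi * Re z)) \<ge> 4"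
        using cos_le_one[of "2 * (pi * Re z)"] by linarith
      then have "(norm (sin (of_real pi * z)))\<^sup>2 \<ge> 1" unfolding norm_sin_squared by simp
      then have "norm (sin (of_real pi * z)) \<ge> 1"
        using power2_le_imp_le[of 1 "norm (sin (of_real pi * z))"] by simp
      then show ?thesis by simp
    qed
  qed
qed

text \<open>
The addition theorem for \<open>sin\<close> reduces the claim to a bound for \<open>cot (\<pi> z)\<close> away from the integers.
\<close>
lemma norm_sin_quotient_le:
  assumes "r > 0" "M \<ge> 0"
  obtains K where "K \<ge> 0"
    "\<And>(z :: complex) \<eta>. \<lbrakk>\<And>j. norm (z - of_int j) \<ge> r; norm \<eta> \<le> M\<rbrakk>
       \<Longrightarrow> norm (sin (of_real pi * (z + \<eta>))) \<le> K * norm (sin (of_real pi * z))"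
proof -
  obtain c where c: "c > 0"
    "\<And>z :: complex. (\<And>j. norm (z - of_int j) \<ge> r) \<Longrightarrow> norm (sin (of_real pi * z)) \<ge> c"
    using norm_sin_pi_ge_away_from_Ints[OF assms(1)] by blast
  have "compact (cball (0 :: complex) (pi * M))" by simp
  then have "bounded ((\<lambda>z :: complex. sin z) ` cball 0 (pi * M))" "bounded ((\<lambda>z :: complex. cos z) ` cball 0 (pi * M))"
    by (intro compact_imp_bounded compact_continuous_image continuous_intros; simp)+
  then obtain B1 B2 where B: "\<And>z :: complex. norm z \<le> pi * M \<Longrightarrow> norm (sin z) \<le> B1"
    "\<And>z :: complex. norm z \<le> pi * M \<Longrightarrow> norm (cos z) \<le> B2"
    unfolding bounded_iff by (metis (no_types, lifting) imageI mem_cball_0)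
  have B0: "B1 \<ge> 0" "B2 \<ge> 0" using B[of 0] assms by auto
  let ?K = "B2 + (1 + 1 / c) * B1"
  show ?thesis
  proof
    show "?K \<ge> 0" using B0 c by simp
    fix z \<eta> :: complex
    assume far: "\<And>j. norm (z - of_int j) \<ge> r" and \<eta>: "norm \<eta> \<le> M"
    let ?s = "norm (sin (of_real pi * z))"
    have s: "?s \<ge> c" using c far by blast
    have "norm (cos (of_real pi * z)) \<le> ?s + 1" by (rule norm_cos_le_norm_sin_plus_1)
    also have "\<dots> \<le> (1 + 1 / c) * ?s" using s c by (simp add: field_simps)
    finally have cos: "norm (cos (of_real pi * z)) \<le> (1 + 1 / c) * ?s" .
    have "norm (of_real pi * \<eta>) \<le> pi * M" using \<eta> by (simp add: norm_mult)
    note b = B[OF this]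
    have "sin (of_real pi * (z + \<eta>)) = sin (of_real pi * z) * cos (of_real pi * \<eta>) + cos (of_real pi * z) * sin (of_real pi * \<eta>)"
      by (simp add: distrib_left sin_add)
    also have "norm \<dots> \<le> ?s * B2 + (1 + 1 / c) * ?s * B1"
      using b cos c by (intro norm_triangle_mono) (auto simp: norm_mult intro!: mult_mono)
    also have "\<dots> = ?K * ?s" by (simp add: algebra_simps)
    finally show "norm (sin (of_real pi * (z + \<eta>))) \<le> ?K * ?s" .
  qed
qed

text \<open>
In the left half-plane the reflection formula replaces the quotient by
\<open>\<Gamma>(1 - \<beta> - z) / \<Gamma>(1 - \<alpha> - z)\<close>, which has the same exponent \<open>\<alpha> - \<beta>\<close>, times a quotient of sines.
That quotient is bounded as long as \<open>z + \<alpha>\<close> keeps its distance from the integers.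
\<close>
lemma norm_Gamma_mult_rGamma_le:
  assumes "M \<ge> 0" "r > 0"
  obtains K R where "K \<ge> 0" "R > 0"
    "\<And>z \<alpha> \<beta>. \<lbrakk>norm z \<ge> R; norm \<alpha> \<le> M; norm \<beta> \<le> M;
               Re z < 0 \<longrightarrow> (\<forall>j. norm (z + \<alpha> - of_int j) \<ge> r)\<rbrakk>
       \<Longrightarrow> norm (Gamma (z + \<alpha>) * rGamma (z + \<beta>)) \<le> K * norm z powr Re (\<alpha> - \<beta>)"
proof -
  obtain K R where K: "K \<ge> 0" "R > 0"
    "\<And>z \<alpha> \<beta>. \<lbrakk>Re z \<ge> 0; norm z \<ge> R; norm \<alpha> \<le> M + 1; norm \<beta> \<le> M + 1\<rbrakk>
       \<Longrightarrow> norm (Gamma (z + \<alpha>) * rGamma (z + \<beta>)) \<le> K * norm z powr Re (\<alpha> - \<beta>)"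
    using norm_Gamma_mult_rGamma_le_right[of "M + 1"] assms by auto
  obtain L where L: "L \<ge> 0"
    "\<And>(z :: complex) \<eta>. \<lbrakk>\<And>j. norm (z - of_int j) \<ge> r; norm \<eta> \<le> 2 * M\<rbrakk>
       \<Longrightarrow> norm (sin (of_real pi * (z + \<eta>))) \<le> L * norm (sin (of_real pi * z))"
    using norm_sin_quotient_le[of r "2 * M"] assms by auto
  let ?K = "(1 + L) * K"
  show ?thesis
  proof
    show "?K \<ge> 0" "max R (2 * M + 1) > 0" using K L by auto
    fix z \<alpha> \<beta> :: complex
    assume z: "norm z \<ge> max R (2 * M + 1)" and \<alpha>: "norm \<alpha> \<le> M" and \<beta>: "norm \<beta> \<le> M"
      and far: "Re z < 0 \<longrightarrow> (\<forall>j. norm (z + \<alpha> - of_int j) \<ge> r)"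
    show "norm (Gamma (z + \<alpha>) * rGamma (z + \<beta>)) \<le> ?K * norm z powr Re (\<alpha> - \<beta>)"
    proof (cases "Re z < 0")
      case False
      then have "norm (Gamma (z + \<alpha>) * rGamma (z + \<beta>)) \<le> K * norm z powr Re (\<alpha> - \<beta>)"
        using z \<alpha> \<beta> by (intro K) auto
      also have "\<dots> \<le> ?K * norm z powr Re (\<alpha> - \<beta>)"
        using K L by (intro mult_right_mono) (auto simp: algebra_simps)
      finally show ?thesis .
    next
      case True
      have far: "norm (z + \<alpha> - of_int j) \<ge> r" for j using far True by blast
      let ?sa = "sin (of_real pi * (z + \<alpha>))" and ?sb = "sin (of_real pi * (z + \<beta>))"
      have sa: "?sa \<noteq> 0"
      proof
        assume "?sa = 0"
        then obtain j :: int where "of_real pi * (z + \<alpha>) = of_real pi * of_int j"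
          by (auto simp: sin_eq_0 mult_ac)
        then have "z + \<alpha> = of_int j" by simp
        then show False using far[of j] assms by simp
      qed
      have nsb: "norm (?sb / ?sa) \<le> L"
        using L(2)[of "z + \<alpha>" "\<beta> - \<alpha>"] far norm_triangle_ineq4[of \<beta> \<alpha>] \<alpha> \<beta> sa
        by (simp add: norm_divide divide_le_eq)
      have ra: "rGamma (z + \<alpha>) * rGamma (1 - (z + \<alpha>)) = ?sa / of_real pi"
        and rb: "rGamma (z + \<beta>) * rGamma (1 - (z + \<beta>)) = ?sb / of_real pi"
        by (rule rGamma_reflection_complex)+
      have inv: "inverse x = p * y / s" if "x * y = s / p" "s \<noteq> 0" "p \<noteq> 0" for x y s p :: complex
        using that by (auto simp: field_simps)
      have b1: "Gamma (z + \<alpha>) = of_real pi * rGamma (1 - (z + \<alpha>)) / ?sa"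
        using inv[OF ra sa] by (simp add: Gamma_def)
      \<comment> \<open>Otherwise \<open>z + \<beta>\<close> is a positive integer, and \<open>Re z < 0\<close> forces \<open>\<bar>z\<bar> \<le> 2 M\<close>.\<close>
      have "1 - (z + \<beta>) \<notin> \<int>\<^sub>\<le>\<^sub>0"
      proof
        assume "1 - (z + \<beta>) \<in> \<int>\<^sub>\<le>\<^sub>0"
        then obtain n where "1 - (z + \<beta>) = - of_nat n" by (elim nonpos_Ints_cases')
        then have n: "z = of_nat (n + 1) - \<beta>" by (simp add: algebra_simps)
        have "real (n + 1) \<le> norm \<beta>"
          using True arg_cong[OF n, of Re] complex_Re_le_cmod[of \<beta>] by simp
        then have "norm z \<le> 2 * M"
          using n \<beta> norm_triangle_ineq4[of "of_nat (n + 1)" \<beta>] by (simp only: norm_of_nat)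
        then show False using z by simp
      qed
      then have b2: "rGamma (z + \<beta>) = ?sb * Gamma (1 - (z + \<beta>)) / of_real pi"
        using rb by (simp add: Gamma_def rGamma_eq_zero_iff divide_simps mult_ac)
      have "Gamma (z + \<alpha>) * rGamma (z + \<beta>)
        = (?sb / ?sa) * (Gamma (- z + (1 - \<beta>)) * rGamma (- z + (1 - \<alpha>)))"
        unfolding b1 b2 by (simp add: algebra_simps)
      also have "norm \<dots> \<le> L * (K * norm (- z) powr Re ((1 - \<beta>) - (1 - \<alpha>)))"
        unfolding norm_mult[of "_ / _"]
        using z True \<alpha> \<beta> norm_triangle_ineq4[of 1 \<alpha>] norm_triangle_ineq4[of 1 \<beta>]
        by (intro mult_mono nsb K) (auto simp: L)
      also have "\<dots> \<le> ?K * norm z powr Re (\<alpha> - \<beta>)"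
        using K by (auto simp: algebra_simps)
      finally show ?thesis .
    qed
  qed
qed

section \<open>Symmetric products over the roots of a quadratic\<close>
text \<open>
This is \<open>f a * f b\<close> for the two roots \<open>a\<close>, \<open>b\<close> of \<open>z\<^sup>2 - w z + c\<close>, as a function of their sum \<open>w\<close>.
\<close>
definition root_prod :: "complex \<Rightarrow> (complex \<Rightarrow> complex) \<Rightarrow> complex \<Rightarrow> complex" where
  "root_prod c f w = f (w / 2 + csqrt (w\<^sup>2 / 4 - c)) * f (w / 2 - csqrt (w\<^sup>2 / 4 - c))"

lemma root_prod_eq:
  assumes "a + b = w" "a * b = c"
  shows "root_prod c f w = f a * f b"
proof -
  let ?r = "csqrt (w\<^sup>2 / 4 - c)"
  have "w\<^sup>2 / 4 - c = ((a - b) / 2)\<^sup>2"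
    unfolding assms[symmetric] by (simp add: power2_eq_square field_simps)
  then have "?r\<^sup>2 = ((a - b) / 2)\<^sup>2" by simp
  then consider "?r = (a - b) / 2" | "?r = - ((a - b) / 2)" by (auto simp only: power2_eq_iff)
  then show ?thesis
  proof cases
    case 1
    then have "w / 2 + ?r = a" "w / 2 - ?r = b" unfolding 1 assms(1)[symmetric] by (simp_all add: field_simps)
    then show ?thesis by (simp add: root_prod_def)
  next
    case 2
    then have "w / 2 + ?r = b" "w / 2 - ?r = a" unfolding 2 assms(1)[symmetric] by (simp_all add: field_simps)
    then show ?thesis by (simp add: root_prod_def)
  qed
qed

text \<open>
The smaller root is named \<open>b\<close>; the last inequality says that it is \<open>O(1 / w)\<close>.
\<close>
lemma roots_exist:
  obtains a b :: complex where "a + b = w" "a * b = c" "norm w * norm b \<le> 2 * norm c"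
proof -
  let ?r = "csqrt (w\<^sup>2 / 4 - c)"
  have *: "(w / 2 + ?r) + (w / 2 - ?r) = w" "(w / 2 + ?r) * (w / 2 - ?r) = c"
    by (simp_all add: square_diff_square_factored[symmetric] flip: power2_eq_square)
       (simp add: power2_eq_square field_simps)
  have le: "norm w * norm b \<le> 2 * norm c" if "a + b = w" "a * b = c" "norm b \<le> norm a" for a b
  proof -
    have "norm w \<le> 2 * norm a" using that norm_triangle_ineq[of a b] by auto
    then have "norm w * norm b \<le> 2 * norm a * norm b" by (intro mult_right_mono) auto
    then show ?thesis using that by (auto simp: norm_mult)
  qed
  show ?thesis
  proof (cases "norm (w / 2 - ?r) \<le> norm (w / 2 + ?r)")
    case True
    then show ?thesis using that le * by blast
  next
    case False
    then show ?thesis using that[of "w / 2 - ?r" "w / 2 + ?r"] le[of "w / 2 - ?r" "w / 2 + ?r"] *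
      by (simp add: add.commute mult.commute)
  qed
qed

text \<open>
Exchanging the roots does not change the product, so near each \<open>w\<close> with nonzero discriminant any holomorphic
branch of the square root may be used. At the finitely many zeros of the discriminant the function is
continuous, hence the singularity is removable.
\<close>
lemma holomorphic_root_prod:
  assumes f: "f holomorphic_on UNIV"
  shows "root_prod c f holomorphic_on UNIV"
proof (rule no_isolated_singularity')
  let ?D = "\<lambda>w :: complex. w\<^sup>2 / 4 - c"
  let ?Z = "{w. ?D w = 0}"
  have fc: "(\<lambda>w. f (g w)) holomorphic_on A" if "g holomorphic_on A" for g A
    using holomorphic_on_compose_gen[OF that f] by (simp add: o_def)
  have "?Z \<subseteq> {2 * csqrt c, - (2 * csqrt c)}"
  proof
    fix w assume "w \<in> ?Z"
    then have "w\<^sup>2 = (2 * csqrt c)\<^sup>2" by (simp add: power_mult_distrib)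
    then show "w \<in> {2 * csqrt c, - (2 * csqrt c)}" by (auto simp only: power2_eq_iff)
  qed
  then show "finite ?Z" using finite_subset by blast
  show "(root_prod c f \<longlongrightarrow> root_prod c f z) (at z within UNIV)" if "z \<in> ?Z" for z
  proof -
    have z: "?D z = 0" using that by simp
    have "((\<lambda>w. sqrt (norm (?D w))) \<longlongrightarrow> sqrt (norm (?D z))) (at z)" by (intro tendsto_intros) auto
    then have "((\<lambda>w. norm (csqrt (?D w))) \<longlongrightarrow> 0) (at z)" using z by simp
    then have r: "((\<lambda>w. csqrt (?D w)) \<longlongrightarrow> 0) (at z)" by (rule tendsto_norm_zero_cancel)
    have "isCont f (z / 2)"
      using f holomorphic_on_imp_continuous_on continuous_on_eq_continuous_at open_UNIV by blast
    then have "(f \<longlongrightarrow> f (z / 2)) (nhds (z / 2))" by (simp add: isCont_def tendsto_at_iff_tendsto_nhds)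
    moreover have "((\<lambda>w. w / 2 + csqrt (?D w)) \<longlongrightarrow> z / 2) (at z)"
      "((\<lambda>w. w / 2 - csqrt (?D w)) \<longlongrightarrow> z / 2) (at z)"
      by (rule tendsto_eq_intros r refl | simp)+
    ultimately have "(root_prod c f \<longlongrightarrow> f (z / 2) * f (z / 2)) (at z)"
      unfolding root_prod_def by (intro tendsto_mult) (erule filterlim_compose; assumption)+
    moreover have "root_prod c f z = f (z / 2) * f (z / 2)" using z by (simp add: root_prod_def)
    ultimately show ?thesis by simp
  qed
  show "root_prod c f holomorphic_on UNIV - ?Z"
  proof -
    have o: "open {w. ?D w \<notin> \<real>\<^sub>\<le>\<^sub>0}" "open {w. - ?D w \<notin> \<real>\<^sub>\<le>\<^sub>0}"
    proof -
      have "open (- ?D -` \<real>\<^sub>\<le>\<^sub>0)" "open (- (\<lambda>w. - ?D w) -` \<real>\<^sub>\<le>\<^sub>0)"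
        by (intro open_Compl closed_vimage continuous_intros closed_nonpos_Reals_complex; simp)+
      then show "open {w. ?D w \<notin> \<real>\<^sub>\<le>\<^sub>0}" "open {w. - ?D w \<notin> \<real>\<^sub>\<le>\<^sub>0}"
        by (simp_all add: vimage_def Compl_eq)
    qed
    \<comment> \<open>The branches \<open>csqrt D\<close> and \<open>\<i> csqrt (- D)\<close> together cover all \<open>D \<noteq> 0\<close>.\<close>
    have "root_prod c f holomorphic_on {w. ?D w \<notin> \<real>\<^sub>\<le>\<^sub>0}"
      unfolding root_prod_def by (intro holomorphic_intros fc) auto
    moreover have "root_prod c f holomorphic_on {w. - ?D w \<notin> \<real>\<^sub>\<le>\<^sub>0}"
    proof -
      have "(\<lambda>w. f (w / 2 + \<i> * csqrt (- ?D w)) * f (w / 2 - \<i> * csqrt (- ?D w)))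
          holomorphic_on {w. - ?D w \<notin> \<real>\<^sub>\<le>\<^sub>0}"
        by (intro holomorphic_intros fc) auto
      moreover have "root_prod c f w = f (w / 2 + \<i> * csqrt (- ?D w)) * f (w / 2 - \<i> * csqrt (- ?D w))" for w
        by (intro root_prod_eq)
           (simp_all add: square_diff_square_factored[symmetric] power_mult_distrib flip: power2_eq_square,
            simp add: power2_eq_square field_simps)
      ultimately show ?thesis by (simp cong: holomorphic_cong)
    qed
    ultimately have "root_prod c f holomorphic_on {w. ?D w \<notin> \<real>\<^sub>\<le>\<^sub>0} \<union> {w. - ?D w \<notin> \<real>\<^sub>\<le>\<^sub>0}"
      using o by (intro holomorphic_on_Un)
    then show ?thesis
      by (rule holomorphic_on_subset) (auto simp: complex_nonpos_Reals_iff complex_eq_iff)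
  qed
qed auto

text \<open>
On the curve \<open>w = x + c / x\<close> the product is \<open>f x * f (c / x)\<close>; the chain rule at \<open>x = a\<close> gives the
derivative in \<open>w\<close>, since \<open>dw / dx = 1 - c / a\<^sup>2 \<noteq> 0\<close>.
\<close>
lemma has_field_derivative_root_prod:
  assumes f: "f holomorphic_on UNIV" and a: "a \<noteq> 0" "a\<^sup>2 \<noteq> c" and f0: "f a = 0"
    and f': "(f has_field_derivative f') (at a)"
  shows "(root_prod c f has_field_derivative f' * f (c / a) / (1 - c / a\<^sup>2)) (at (a + c / a))"
proof -
  let ?D = "deriv (root_prod c f) (a + c / a)"
  have D: "(root_prod c f has_field_derivative ?D) (at (a + c / a))"
    using holomorphic_derivI[OF holomorphic_root_prod[OF f]] by auto
  have "((\<lambda>x. x + c / x) has_field_derivative 1 - c / a\<^sup>2) (at a)"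
    using a by (auto intro!: derivative_eq_intros simp: power2_eq_square)
  from DERIV_chain2[OF D this]
  have 1: "((\<lambda>x. root_prod c f (x + c / x)) has_field_derivative ?D * (1 - c / a\<^sup>2)) (at a)" .
  have fc: "(f has_field_derivative deriv f (c / a)) (at (c / a))"
    using holomorphic_derivI[OF f] by auto
  have "((\<lambda>x. c / x) has_field_derivative - c / a\<^sup>2) (at a)"
    using a by (auto intro!: derivative_eq_intros simp: power2_eq_square)
  from DERIV_mult[OF f' DERIV_chain2[OF fc this]]
  have 2: "((\<lambda>x. f x * f (c / x)) has_field_derivative f' * f (c / a)) (at a)"
    using f0 by simp
  have "((\<lambda>x. root_prod c f (x + c / x)) has_field_derivative f' * f (c / a)) (at a)"
  proof (rule has_field_derivative_transform_within_open[OF 2])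
    show "open (- {0 :: complex})" by auto
    show "f x * f (c / x) = root_prod c f (x + c / x)" if "x \<in> - {0}" for x
      using that by (subst root_prod_eq[of x "c / x"]) auto
  qed (use a in auto)
  from DERIV_unique[OF 1 this] have "?D * (1 - c / a\<^sup>2) = f' * f (c / a)" .
  moreover have "1 - c / a\<^sup>2 \<noteq> 0" using a by auto
  ultimately have "?D = f' * f (c / a) / (1 - c / a\<^sup>2)" by (simp add: field_simps)
  then show ?thesis using D by simp
qed

section \<open>Residues and rectangular contours\<close>
text \<open>
The numerator is allowed to vanish at \<open>z\<close>; the singularity is then removable and the formula gives \<open>0\<close>.
\<close>
lemma residue_quotient_simple_zero:
  assumes f: "f holomorphic_on UNIV" and g: "g holomorphic_on UNIV"
    and g0: "g z = 0" and g': "(g has_field_derivative g') (at z)" "g' \<noteq> 0"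
  shows "residue (\<lambda>w. f w / g w) z = f z / g'"
proof -
  have lim: "((\<lambda>w. g w / (w - z)) \<longlongrightarrow> g') (at z)"
    using g'(1) g0 by (simp add: has_field_derivative_iff)
  have "eventually (\<lambda>w. g w / (w - z) \<noteq> 0) (at z)"
    using tendsto_imp_eventually_ne[OF lim g'(2)] .
  then obtain e where e: "e > 0" "\<And>w. w \<noteq> z \<Longrightarrow> dist w z < e \<Longrightarrow> g w \<noteq> 0"
    unfolding eventually_at by force
  have "isCont f z"
    using f holomorphic_on_imp_continuous_on continuous_on_eq_continuous_at open_UNIV by blast
  then have fl: "(f \<longlongrightarrow> f z) (at z)" by (simp add: isCont_def)
  show ?thesis
  proof (rule residue_simple')
    show "open (ball z e)" "z \<in> ball z e" using e by auto
    show "(\<lambda>w. f w / g w) holomorphic_on ball z e - {z}"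
      using e f g by (intro holomorphic_intros) (auto simp: dist_commute intro: holomorphic_on_subset)
    have "((\<lambda>w. f w / (g w / (w - z))) \<longlongrightarrow> f z / g') (at z)"
      by (intro tendsto_divide fl lim g')
    then show "((\<lambda>w. f w / g w * (w - z)) \<longlongrightarrow> f z / g') (at z)" by simp
  qed
qed

lemma norm_residue_le:
  assumes "r > 0" "r < r'" "f holomorphic_on ball z r' - {z}" "B \<ge> 0"
    "\<And>w. dist z w = r \<Longrightarrow> norm (f w) \<le> B"
  shows "norm (residue f z) \<le> B * r"
proof -
  have "(f has_contour_integral 2 * pi * \<i> * residue f z) (circlepath z r)"
    using assms by (intro base_residue[of "ball z r'"]) auto
  then have "norm (2 * pi * \<i> * residue f z) \<le> B * (2 * pi * r)"
    using assms by (intro has_contour_integral_bound_circlepath) (auto simp: dist_norm norm_minus_commute)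
  then show ?thesis by (simp add: norm_mult)
qed

lemma norm_contour_integral_rectpath_le:
  assumes "continuous_on (path_image (rectpath a b)) f" "Re a \<le> Re b" "Im a \<le> Im b" "B \<ge> 0"
    "\<And>w. w \<in> path_image (rectpath a b) \<Longrightarrow> norm (f w) \<le> B"
  shows "norm (contour_integral (rectpath a b) f) \<le> B * (2 * ((Re b - Re a) + (Im b - Im a)))"
proof -
  let ?c = "Complex (Re b) (Im a)" and ?d = "Complex (Re a) (Im b)"
  have im: "path_image (rectpath a b) = closed_segment a ?c \<union> closed_segment ?c b \<union> closed_segment b ?d \<union> closed_segment ?d a"
    by (simp add: rectpath_def Let_def path_image_join Un_assoc)
  have int: "f contour_integrable_on linepath p q" and bd: "norm (contour_integral (linepath p q) f) \<le> B * norm (q - p)"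
    if "closed_segment p q \<subseteq> path_image (rectpath a b)" for p q
  proof -
    show i: "f contour_integrable_on linepath p q"
      using that assms(1) by (intro contour_integrable_continuous_linepath) (rule continuous_on_subset)
    show "norm (contour_integral (linepath p q) f) \<le> B * norm (q - p)"
      using that assms by (intro has_contour_integral_bound_linepath[OF has_contour_integral_integral[OF i]]) auto
  qed
  have seg: "closed_segment a ?c \<subseteq> path_image (rectpath a b)" "closed_segment ?c b \<subseteq> path_image (rectpath a b)"
    "closed_segment b ?d \<subseteq> path_image (rectpath a b)" "closed_segment ?d a \<subseteq> path_image (rectpath a b)"
    unfolding im by blast+
  note ints = seg[THEN int]
  have "contour_integral (rectpath a b) f = contour_integral (linepath a ?c) f + (contour_integral (linepath ?c b) f
    + (contour_integral (linepath b ?d) f + contour_integral (linepath ?d a) f))"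
    using ints by (simp add: rectpath_def Let_def)
  also have "norm \<dots> \<le> B * norm (?c - a) + (B * norm (b - ?c) + (B * norm (?d - b) + B * norm (a - ?d)))"
    by (intro norm_triangle_mono bd seg)
  also have "?c - a = of_real (Re b - Re a)" by (simp add: complex_eq_iff)
  also have "b - ?c = \<i> * of_real (Im b - Im a)" by (simp add: complex_eq_iff)
  also have "?d - b = of_real (Re a - Re b)" by (simp add: complex_eq_iff)
  also have "a - ?d = \<i> * of_real (Im a - Im b)" by (simp add: complex_eq_iff)
  finally show ?thesis using assms(2,3) by (simp add: norm_mult algebra_simps del: of_real_diff)
qed

text \<open>
This is the residue theorem on a disc containing the rectangle, with the trivial bound for the integral;
the poles in the disc but outside the rectangle have winding number zero.
\<close>
lemma norm_sum_residues_rectangle_le: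
  assumes P: "\<And>R. finite (P \<inter> ball 0 R)" and f: "f holomorphic_on - P"
    and ab: "Re a < Re b" "Im a < Im b" and "B \<ge> 0"
    and bd: "\<And>w. w \<in> path_image (rectpath a b) \<Longrightarrow> w \<notin> P \<and> norm (f w) \<le> B"
  shows "norm (2 * pi * \<i> * (\<Sum>p\<in>P \<inter> box a b. residue f p)) \<le> B * (2 * ((Re b - Re a) + (Im b - Im a)))"
proof -
  have "bounded (cbox a b)" by simp
  then obtain R where R: "cbox a b \<subseteq> ball 0 R"
    using bounded_subset_ballD by blast
  let ?g = "rectpath a b"
  have im: "path_image ?g \<subseteq> cbox a b" using ab by (intro path_image_rectpath_subset_cbox) auto
  have boxR: "box a b \<subseteq> ball 0 R" using R box_subset_cbox by blast
  have eq: "(\<Sum>p\<in>P \<inter> ball 0 R. winding_number ?g p * residue f p) = (\<Sum>p\<in>P \<inter> box a b. residue f p)"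
  proof (rule sum.mono_neutral_cong_right)
    show "\<forall>p \<in> P \<inter> ball 0 R - P \<inter> box a b. winding_number ?g p * residue f p = 0"
    proof
      fix p assume p: "p \<in> P \<inter> ball 0 R - P \<inter> box a b"
      then have "p \<notin> path_image ?g" using bd by auto
      then have "p \<notin> cbox a b" using p ab by (auto simp: path_image_rectpath_cbox_minus_box)
      then show "winding_number ?g p * residue f p = 0" using ab by (simp add: winding_number_rectpath_outside)
    qed
  qed (use P boxR in \<open>auto simp: winding_number_rectpath\<close>)
  have "contour_integral ?g f = 2 * pi * \<i> * (\<Sum>p\<in>P \<inter> ball 0 R. winding_number ?g p * residue f p)"
  proof (rule Residue_theorem[OF open_ball connected_ball P])
    show "f holomorphic_on ball 0 R - P \<inter> ball 0 R" using f by (rule holomorphic_on_subset) auto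
    show "path_image ?g \<subseteq> ball 0 R - P \<inter> ball 0 R" using im R bd by auto
    show "\<forall>z. z \<notin> ball 0 R \<longrightarrow> winding_number ?g z = 0"
      using R ab by (auto intro!: winding_number_rectpath_outside)
  qed auto
  moreover have "continuous_on (path_image ?g) f"
    using f bd by (intro holomorphic_on_imp_continuous_on) (auto elim: holomorphic_on_subset)
  then have "norm (contour_integral ?g f) \<le> B * (2 * ((Re b - Re a) + (Im b - Im a)))"
    using ab bd \<open>B \<ge> 0\<close> by (intro norm_contour_integral_rectpath_le) auto
  ultimately show ?thesis using eq by simp
qed

lemma plus_nat_nonzero:
  assumes "z \<notin> \<int>\<^sub>\<le>\<^sub>0"
  shows "z + of_nat k \<noteq> (0 :: complex)"
proof
  assume "z + of_nat k = 0"
  then have "z = - of_nat k" by (simp add: eq_neg_iff_add_eq_0)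
  with assms show False by simp
qed

lemma norm_int_diff_ge_1: "j \<noteq> k \<Longrightarrow> norm (of_int j - of_int k :: complex) \<ge> 1"
proof -
  assume "j \<noteq> k"
  then have "\<bar>j - k\<bar> \<ge> 1" by simp
  then have "real_of_int \<bar>j - k\<bar> \<ge> 1" by linarith
  then show ?thesis by (metis norm_of_int of_int_abs of_int_diff)
qed

lemma abs_of_int_plus_half_ge: "\<bar>real_of_int m + 1 / 2\<bar> \<ge> 1 / 2"
proof (cases "m \<ge> 0")
  case False
  then have "real_of_int m \<le> - 1" by linarith
  then show ?thesis by linarith
qed simp

lemma eventually_large: "eventually (\<lambda>n. real n \<ge> c) sequentially"
  using filterlim_real_sequentially unfolding filterlim_at_top by blast

lemma tendsto_sum_exhausting:
  fixes f :: "nat \<Rightarrow> 'a :: banach"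
  assumes "summable (\<lambda>k. norm (f k))" "\<And>n. finite (A n)"
    and "\<And>k. eventually (\<lambda>n. k \<in> A n) sequentially"
  shows "(\<lambda>n. \<Sum>k\<in>A n. f k) \<longlonglongrightarrow> suminf f"
proof -
  have "(f has_sum suminf f) UNIV"
    using assms(1) summable_norm_cancel by (intro norm_summable_imp_has_sum) (auto simp: sums_iff)
  moreover have "filterlim A (finite_subsets_at_top UNIV) sequentially"
    unfolding filterlim_finite_subsets_at_top
  proof (intro allI impI)
    fix X :: "nat set" assume "finite X \<and> X \<subseteq> UNIV"
    then have "eventually (\<lambda>n. \<forall>k\<in>X. k \<in> A n) sequentially"
      using assms(3) by (intro eventually_ball_finite) auto
    then show "eventually (\<lambda>n. finite (A n) \<and> X \<subseteq> A n \<and> A n \<subseteq> UNIV) sequentially"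
      by eventually_elim (use assms(2) in auto)
  qed
  ultimately show ?thesis unfolding has_sum_def by (rule filterlim_compose)
qed

section \<open>The meromorphic function on the curve and its residues\<close>
locale gamma_curve =
  fixes x1 x2 s t u l :: complex
  assumes delta: "Re (2 * l - s + t + u) > 0"
    and x1: "x1 \<notin> \<int>\<^sub>\<le>\<^sub>0" and x2: "x2 \<notin> \<int>\<^sub>\<le>\<^sub>0" and x3: "s - x1 - x2 \<notin> \<int>\<^sub>\<le>\<^sub>0"
    and l: "l \<notin> \<int>\<^sub>\<le>\<^sub>0"
    and l_eps: "\<And>k. l - eps x1 x2 l k \<notin> \<int>\<^sub>\<le>\<^sub>0"
    and s_eps: "\<And>k. s - l + eps x1 x2 l k + of_nat k \<notin> \<int>\<^sub>\<le>\<^sub>0"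
    and c_plus: "\<And>k. c_plus x1 x2 s l k \<notin> \<int>\<^sub>\<le>\<^sub>0"
    and c_minus: "\<And>k. c_minus x1 x2 s l k \<notin> \<int>\<^sub>\<le>\<^sub>0"
begin

text \<open>
In these names \<open>H\<close> is the function \<open>G w / (w - w0)\<close> described above, written as a quotient of entire
functions: every Gamma factor of \<open>G\<close> is put as \<open>rGamma\<close> into the denominator. So the poles of \<open>H\<close> lie among the
zeros of \<open>denom\<close>, and residues are computed from the derivative of \<open>denom\<close>.
\<close>
definition C where "C = (l - x1) * (l - x2)"
definition w0 where "w0 = 2 * l - x1 - x2"
definition W where "W k = l + of_nat k + eps x1 x2 l k" for k
definition V where "V k = 2 * l - s - of_nat k" for k :: nat
definition \<delta> where "\<delta> = Re (2 * l - s + t + u)"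

definition numer where
  "numer w = root_prod C (\<lambda>a. rGamma (t - l + a)) w * rGamma (u + 2 * l - w)"
definition denom where
  "denom w = root_prod C (\<lambda>a. rGamma (l - a)) w * rGamma (s - 2 * l + w) * (w - w0)"
definition H where "H w = numer w / denom w"
definition poles where "poles = insert w0 (range W \<union> range V)"

lemma delta_pos: "\<delta> > 0"
  using delta by (simp add: \<delta>_def)

lemma l_plus_nonzero: "l + of_nat k \<noteq> 0"
  by (rule plus_nat_nonzero[OF l])

lemma eps_eq: "eps x1 x2 l k = C / (l + of_nat k)"
  by (simp add: eps_def C_def)

text \<open>
For \<open>j = k\<close> this keeps \<open>W k\<close> away from the branch points of the parametrization, where the two roots
coincide and \<open>dw / da\<close> vanishes, and for \<open>j \<noteq> k\<close> it keeps \<open>W j\<close> and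
\<open>W k\<close> apart.
\<close>
lemma eps_ne: "eps x1 x2 l k \<noteq> l + of_nat j"
proof
  assume "eps x1 x2 l k = l + of_nat j"
  then have "l - eps x1 x2 l k = - of_nat j" by simp
  then show False using l_eps[of k] by simp
qed

lemma W_minus_w0: "(l + of_nat k) * (W k - w0) = (x1 + of_nat k) * (x2 + of_nat k)"
  using l_plus_nonzero[of k] unfolding W_def eps_def w0_def by (simp add: field_simps)

lemma W_ne_w0: "W k \<noteq> w0"
  using W_minus_w0[of k] plus_nat_nonzero[OF x1, of k] plus_nat_nonzero[OF x2, of k] by auto

lemma V_ne_w0: "V k \<noteq> w0"
proof
  assume "V k = w0"
  then have "(s - x1 - x2) + of_nat k = 0" by (simp add: V_def w0_def algebra_simps)
  then show False using plus_nat_nonzero[OF x3] by blast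
qed

lemma W_ne_V: "W k \<noteq> V j"
proof
  assume "W k = V j"
  then have "(s - l + eps x1 x2 l k + of_nat k) + of_nat j = 0"
    by (simp add: V_def W_def algebra_simps)
  then show False using plus_nat_nonzero[OF s_eps] by blast
qed

lemma W_diff: "W j - W k = (of_nat j - of_nat k) * (1 - eps x1 x2 l j / (l + of_nat k))"
proof -
  have "(p + c / p) - (q + c / q) = (p - q) * (1 - c / p / q)" if "p \<noteq> 0" "q \<noteq> 0" for p q c :: complex
    using that by (simp add: field_simps)
  from this[OF l_plus_nonzero[of j] l_plus_nonzero[of k], of C] show ?thesis
    by (simp add: W_def eps_eq)
qed

lemma inj_W: "inj W"
proof
  fix j k assume "W j = W k"
  then have "(of_nat j - of_nat k) * (1 - eps x1 x2 l j / (l + of_nat k)) = 0"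
    using W_diff[of j k] by simp
  moreover have "1 - eps x1 x2 l j / (l + of_nat k) \<noteq> 0"
    using eps_ne[of j k] l_plus_nonzero[of k] by (simp add: field_simps)
  ultimately have "of_nat j - of_nat k = (0 :: complex)" using mult_eq_0_iff by blast
  then show "j = k" by simp
qed

lemma inj_V: "inj V"
  by (auto simp: inj_def V_def)

lemma holomorphic_numer: "numer holomorphic_on UNIV"
  unfolding numer_def by (intro holomorphic_intros holomorphic_root_prod)

lemma holomorphic_denom: "denom holomorphic_on UNIV"
  unfolding denom_def by (intro holomorphic_intros holomorphic_root_prod)

lemma denom_zero_imp_pole: "denom w = 0 \<Longrightarrow> w \<in> poles"
proof -
  assume "denom w = 0"
  then consider "root_prod C (\<lambda>a. rGamma (l - a)) w = 0" | "rGamma (s - 2 * l + w) = 0" | "w = w0"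
    by (auto simp: denom_def)
  then show ?thesis
  proof cases
    case 1
    obtain a b where ab: "a + b = w" "a * b = C" using roots_exist by blast
    have *: "w \<in> range W" if "p + q = w" "p * q = C" "l - p \<in> \<int>\<^sub>\<le>\<^sub>0" for p q
    proof -
      note pq = that
      obtain k where "l - p = - of_nat k" using nonpos_Ints_cases'[OF pq(3)] by blast
      then have p: "p = l + of_nat k" by (simp add: algebra_simps)
      then have "q = eps x1 x2 l k" using pq l_plus_nonzero[of k] by (auto simp: eps_eq field_simps)
      then have "w = W k" using pq p by (simp add: W_def)
      then show ?thesis by simp
    qed
    from 1 have "l - a \<in> \<int>\<^sub>\<le>\<^sub>0 \<or> l - b \<in> \<int>\<^sub>\<le>\<^sub>0"
      using root_prod_eq[OF ab, of "\<lambda>a. rGamma (l - a)"] by (auto simp: rGamma_eq_zero_iff)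
    then show ?thesis using *[of a b] *[of b a] ab by (auto simp: poles_def ac_simps)
  next
    case 2
    then obtain k where "s - 2 * l + w = - of_nat k" by (auto simp: rGamma_eq_zero_iff elim: nonpos_Ints_cases')
    then have "w = V k" by (simp add: V_def algebra_simps eq_neg_iff_add_eq_0)
    then show ?thesis by (simp add: poles_def)
  qed (simp add: poles_def)
qed

lemma holomorphic_H: "H holomorphic_on - poles"
  unfolding H_def using denom_zero_imp_pole
  by (intro holomorphic_intros holomorphic_on_subset[OF holomorphic_numer]
        holomorphic_on_subset[OF holomorphic_denom]) auto

lemma roots_w0: "(l - x1) + (l - x2) = w0" "(l - x1) * (l - x2) = C"
  by (simp_all add: w0_def C_def)

lemma roots_W: "(l + of_nat k) + eps x1 x2 l k = W k" "(l + of_nat k) * eps x1 x2 l k = C"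
  using l_plus_nonzero[of k] by (simp_all add: W_def eps_eq)

lemma roots_V:
  "(l - c_plus x1 x2 s l k) + (l - c_minus x1 x2 s l k) = V k"
  "(l - c_plus x1 x2 s l k) * (l - c_minus x1 x2 s l k) = C"
proof -
  let ?S = "s + of_nat k" and ?r = "csqrt (c_disc x1 x2 s l k)"
  show "(l - c_plus x1 x2 s l k) + (l - c_minus x1 x2 s l k) = V k"
    by (simp add: c_plus_def c_minus_def V_def field_simps)
  have "(l - c_plus x1 x2 s l k) * (l - c_minus x1 x2 s l k) = (l - ?S / 2)\<^sup>2 - ?r\<^sup>2"
    by (simp add: c_plus_def c_minus_def power2_eq_square algebra_simps del: csqrt_eq_0)
  also have "?r\<^sup>2 = c_disc x1 x2 s l k" by simp
  also have "(l - ?S / 2)\<^sup>2 - c_disc x1 x2 s l k = C" by (simp add: c_disc_def C_def power2_eq_square field_simps)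
  finally show "(l - c_plus x1 x2 s l k) * (l - c_minus x1 x2 s l k) = C" .
qed

lemma residue_H_eq:
  assumes "denom w = 0" "(denom has_field_derivative d) (at w)" "d \<noteq> 0"
  shows "residue H w = numer w / d"
proof -
  have "residue (\<lambda>w. numer w / denom w) w = numer w / d"
    using holomorphic_numer holomorphic_denom assms by (rule residue_quotient_simple_zero)
  then show ?thesis by (simp add: H_def[abs_def])
qed

lemma residue_w0:
  "residue H w0 = Gamma x1 * Gamma x2 * Gamma (s - x1 - x2)
      * (rGamma (t - x1) * rGamma (t - x2) * rGamma (u + x1 + x2))"
proof -
  let ?E = "\<lambda>w. root_prod C (\<lambda>a. rGamma (l - a)) w * rGamma (s - 2 * l + w)"
  have E0: "?E w0 = rGamma x1 * rGamma x2 * rGamma (s - x1 - x2)"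
    unfolding root_prod_eq[OF roots_w0] by (simp add: w0_def algebra_simps)
  have "?E holomorphic_on UNIV" by (intro holomorphic_intros holomorphic_root_prod)
  then have "(?E has_field_derivative deriv ?E w0) (at w0)" using holomorphic_derivI by blast
  moreover have "((\<lambda>w. w - w0) has_field_derivative 1) (at w0)" by (auto intro!: derivative_eq_intros)
  ultimately have "(denom has_field_derivative ?E w0) (at w0)"
    unfolding denom_def using DERIV_mult[of ?E _ w0 UNIV "\<lambda>w. w - w0" 1] by simp
  then have "residue H w0 = numer w0 / ?E w0"
    using x1 x2 x3 by (intro residue_H_eq) (auto simp: denom_def E0 rGamma_eq_zero_iff)
  also have "numer w0 = rGamma (t - x1) * rGamma (t - x2) * rGamma (u + x1 + x2)"
    unfolding numer_def root_prod_eq[OF roots_w0] by (simp add: w0_def algebra_simps)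
  finally show ?thesis unfolding E0 Gamma_def by (simp add: divide_inverse mult_ac)
qed

lemma residue_V: "residue H (V k) = - term2 x1 x2 s t u l k"
proof -
  let ?cp = "c_plus x1 x2 s l k" and ?cm = "c_minus x1 x2 s l k"
  let ?E = "root_prod C (\<lambda>a. rGamma (l - a))"
  let ?d = "rGamma ?cp * rGamma ?cm * ((- 1) ^ k * fact k) * (V k - w0)"
  define D where "D = s + of_nat k - x1 - x2"
  have E0: "?E (V k) = rGamma ?cp * rGamma ?cm"
    unfolding root_prod_eq[OF roots_V] by simp
  have sV: "s - 2 * l + V k = - of_nat k" by (simp add: V_def)
  have rV: "rGamma (s - 2 * l + V k) = 0" unfolding sV by (simp add: rGamma_eq_zero_iff)
  have "?E holomorphic_on UNIV" by (intro holomorphic_intros holomorphic_root_prod)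
  then have dE: "(?E has_field_derivative deriv ?E (V k)) (at (V k))" using holomorphic_derivI by blast
  have dG: "((\<lambda>w. rGamma (s - 2 * l + w)) has_field_derivative (- 1) ^ k * fact k) (at (V k))"
  proof -
    have "(rGamma has_field_derivative (- 1) ^ k * fact k) (at (s - 2 * l + V k))"
      unfolding sV by (rule has_field_derivative_rGamma_nonpos_int)
    moreover have "((\<lambda>w. s - 2 * l + w) has_field_derivative 1) (at (V k))"
      by (auto intro!: derivative_eq_intros)
    ultimately show ?thesis
      using DERIV_chain2[where f = rGamma and g = "\<lambda>w. s - 2 * l + w" and Db = 1] by fastforce
  qed
  have "(denom has_field_derivative ?d) (at (V k))"
    unfolding denom_def
    by (rule derivative_eq_intros dE dG refl)+ (simp add: rV E0)
  then have "residue H (V k) = numer (V k) / ?d"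
    using c_plus[of k] c_minus[of k] V_ne_w0[of k]
    by (intro residue_H_eq) (auto simp: denom_def rV rGamma_eq_zero_iff)
  also have "numer (V k) = rGamma (t - ?cp) * rGamma (t - ?cm) * rGamma (u + s + of_nat k)"
    unfolding numer_def root_prod_eq[OF roots_V] by (simp add: V_def algebra_simps)
  also have "V k - w0 = - D" by (simp add: V_def w0_def D_def)
  finally show ?thesis
    unfolding term2_def D_def[symmetric] Gamma_def by (simp add: divide_inverse mult_ac power_inverse[symmetric] inverse_minus_eq)
qed

text \<open>
At \<open>w = W k\<close> the roots are \<open>\<lambda> + k\<close> and \<open>\<epsilon>\<^sub>k\<close>. The Jacobian \<open>1 - \<epsilon>\<^sub>k / (\<lambda> + k)\<close> of the parametrization divided
by \<open>W k - w0\<close> is the bracket \<open>1 / (x\<^sub>1 + k) + 1 / (x\<^sub>2 + k) - 1 / (\<lambda> + k)\<close>.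
\<close>
lemma residue_W: "residue H (W k) = - term1 x1 x2 s t u l k"
proof -
  let ?e = "eps x1 x2 l k" and ?A = "l + of_nat k"
  let ?E = "root_prod C (\<lambda>a. rGamma (l - a))"
  let ?E' = "- ((- 1) ^ k * fact k) * rGamma (l - ?e) / (1 - ?e / ?A)"
  let ?d = "?E' * rGamma (s - l + ?e + of_nat k) * (W k - w0)"
  have A0: "?A \<noteq> 0" by (rule l_plus_nonzero)
  have CA: "C / ?A = ?e" by (simp add: eps_eq)
  have lA: "l - ?A = - of_nat k" by simp
  have E0: "?E (W k) = 0"
    unfolding root_prod_eq[OF roots_W] by (simp add: rGamma_eq_zero_iff)
  have q: "1 - ?e / ?A \<noteq> 0" using eps_ne[of k k] A0 by (simp add: field_simps)
  have "((\<lambda>a. rGamma (l - a)) has_field_derivative - ((- 1) ^ k * fact k)) (at ?A)"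
  proof -
    have "(rGamma has_field_derivative (- 1) ^ k * fact k) (at (l - ?A))"
      unfolding lA by (rule has_field_derivative_rGamma_nonpos_int)
    moreover have "((\<lambda>w. l - w) has_field_derivative - 1) (at ?A)"
      by (auto intro!: derivative_eq_intros)
    ultimately show ?thesis
      using DERIV_chain2[where f = rGamma and g = "\<lambda>w. l - w" and Db = "- 1"] by fastforce
  qed
  then have "(?E has_field_derivative - ((- 1) ^ k * fact k) * rGamma (l - C / ?A) / (1 - C / ?A\<^sup>2)) (at (?A + C / ?A))"
  proof (intro has_field_derivative_root_prod)
    show "?A\<^sup>2 \<noteq> C" using eps_ne[of k k] A0 by (auto simp: eps_eq power2_eq_square field_simps)
  qed (use A0 in \<open>auto intro!: holomorphic_intros simp: rGamma_eq_zero_iff\<close>)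
  then have dE: "(?E has_field_derivative ?E') (at (W k))"
    unfolding CA by (simp add: W_def CA[symmetric] power2_eq_square)
  have "(\<lambda>w. rGamma (s - 2 * l + w) * (w - w0)) holomorphic_on UNIV" (is "?G holomorphic_on _")
    by (intro holomorphic_intros)
  then have dG: "(?G has_field_derivative deriv ?G (W k)) (at (W k))" using holomorphic_derivI by blast
  have G: "?G (W k) = rGamma (s - l + ?e + of_nat k) * (W k - w0)" by (simp add: W_def algebra_simps)
  have "((\<lambda>w. ?E w * ?G w) has_field_derivative ?E' * ?G (W k)) (at (W k))"
    using DERIV_mult[OF dE dG] E0 by simp
  moreover have "denom = (\<lambda>w. ?E w * ?G w)" by (simp add: denom_def fun_eq_iff)
  ultimately have "(denom has_field_derivative ?d) (at (W k))" unfolding G by (simp add: mult_ac)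
  then have "residue H (W k) = numer (W k) / ?d"
    using l_eps[of k] s_eps[of k] W_ne_w0[of k] q
    by (intro residue_H_eq) (auto simp: denom_def E0 rGamma_eq_zero_iff)
  also have "numer (W k) = rGamma (t + of_nat k) * rGamma (t - l + ?e) * rGamma (u + l - ?e - of_nat k)"
    unfolding numer_def root_prod_eq[OF roots_W] by (simp add: W_def algebra_simps)
  also have "W k - w0 = (1 - ?e / ?A) / (1 / (x1 + of_nat k) + 1 / (x2 + of_nat k) - 1 / ?A)"
  proof -
    let ?p = "x1 + of_nat k" and ?q = "x2 + of_nat k"
    have pq: "?p \<noteq> 0" "?q \<noteq> 0" using plus_nat_nonzero x1 x2 by blast+
    have W: "W k - w0 = ?p * ?q / ?A" using W_minus_w0[of k] A0 by (simp add: field_simps)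
    have e: "?e = (?A - ?p) * (?A - ?q) / ?A" by (simp add: eps_def)
    have "1 - (A - p) * (A - q) / A / A = (p * q / A) * (1 / p + 1 / q - 1 / A)"
      if "p \<noteq> 0" "q \<noteq> 0" "A \<noteq> 0" for p q A :: complex
      using that by (simp add: field_simps)
    from this[OF pq A0] have *: "1 - ?e / ?A = (?p * ?q / ?A) * (1 / ?p + 1 / ?q - 1 / ?A)"
      unfolding e .
    then have "1 / ?p + 1 / ?q - 1 / ?A \<noteq> 0" using q by auto
    then show ?thesis unfolding W * by (rule nonzero_mult_div_cancel_right[symmetric])
  qed
  finally show ?thesis
    unfolding term1_def Gamma_def using q by (simp add: divide_inverse mult_ac power_inverse[symmetric])
qed

section \<open>Decay away from the poles\<close>
text \<open>
Far out, the poles of \<open>H\<close> in the right half-plane are close to \<open>\<lambda> + k\<close>, and those in the left one are the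
points \<open>2\<lambda> - s - k\<close>. The sines from the reflection formula have zeros close to all points of the lattices
\<open>\<lambda> + \<int>\<close> and \<open>2\<lambda> - s + \<int>\<close>, so the distance is measured to these, but only in the half-plane where the reflection
formula is used.
\<close>
definition off_lattices where
  "off_lattices w \<longleftrightarrow> (Re w < 0 \<longrightarrow> (\<forall>j :: int. norm (w + (s - 2 * l) - of_int j) \<ge> 1 / 8)) \<and>
     (Re w > 0 \<longrightarrow> (\<forall>j :: int. norm (w - l - of_int j) \<ge> 1 / 8))"

text \<open>
With \<open>a = w - b\<close> and \<open>b\<close> small, \<open>G w\<close> is the product of three quotients of Gamma values: a bounded one depending
on \<open>b\<close> only, one at \<open>w\<close> and one at \<open>- w\<close>. The exponents of the last two add up to \<open>- \<delta> + 2 Re b\<close>,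
and \<open>\<bar>b\<bar> \<le> \<delta> / 4\<close> for large \<open>w\<close>.
\<close>
lemma norm_H_le:
  obtains K R where "K \<ge> 0"
    "\<And>w. norm w \<ge> R \<Longrightarrow> off_lattices w \<Longrightarrow> norm (H w) \<le> K * norm w powr (- 1 - \<delta> / 2)"
proof -
  have "isCont (\<lambda>b. Gamma (l - b) * rGamma (t - l + b)) 0"
    using l by (intro continuous_intros) auto
  then obtain \<rho> where \<rho>: "\<rho> > 0"
    "\<And>b. norm b < \<rho> \<Longrightarrow> norm (Gamma (l - b) * rGamma (t - l + b) - Gamma l * rGamma (t - l)) < 1"
    unfolding continuous_at_eps_delta by (auto simp: dist_norm) (metis zero_less_one)
  define B where "B = norm (Gamma l * rGamma (t - l)) + 1"
  have B: "norm (Gamma (l - b) * rGamma (t - l + b)) \<le> B" if "norm b < \<rho>" for b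
    using \<rho>(2)[OF that] norm_triangle_ineq2[of "Gamma (l - b) * rGamma (t - l + b)" "Gamma l * rGamma (t - l)"]
    unfolding B_def by linarith
  define M where "M = norm (s - 2 * l) + norm (t - l) + norm l + norm (u + 2 * l) + 1"
  have M: "M \<ge> 0" by (simp add: M_def)
  have r16: "1 / 16 > (0 :: real)" by simp
  obtain K R where K: "K \<ge> 0" "R > 0" and
    ratio: "\<And>z \<alpha> \<beta>. \<lbrakk>norm z \<ge> R; norm \<alpha> \<le> M; norm \<beta> \<le> M;
               Re z < 0 \<longrightarrow> (\<forall>j. norm (z + \<alpha> - of_int j) \<ge> 1 / 16)\<rbrakk>
       \<Longrightarrow> norm (Gamma (z + \<alpha>) * rGamma (z + \<beta>)) \<le> K * norm z powr Re (\<alpha> - \<beta>)"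
    using norm_Gamma_mult_rGamma_le[OF M r16] by blast
  define e where "e = min (\<rho> / 2) (min (1 / 16) (\<delta> / 4))"
  have e: "e > 0" "e < \<rho>" "e \<le> 1 / 16" "e \<le> \<delta> / 4" using \<rho> delta_pos by (auto simp: e_def)
  define R' where "R' = max (max R 1) (max (2 * norm C / e) (2 * norm w0))"
  show ?thesis
  proof
    show "2 * B * K * K \<ge> 0" using K by (simp add: B_def)
    fix w assume w: "norm w \<ge> R'" and far: "off_lattices w"
    have w1: "norm w \<ge> R" "norm w \<ge> 1" "norm w \<ge> 2 * norm w0" "norm w \<ge> 2 * norm C / e"
      using w by (auto simp: R'_def)
    obtain a b where ab: "a + b = w" "a * b = C" and le: "norm w * norm b \<le> 2 * norm C"
      using roots_exist by blast
    have "norm w * norm b \<le> norm w * e"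
    proof -
      have "2 * norm C \<le> norm w * e" using w1(4) e(1) by (simp add: field_simps)
      then show ?thesis using le by linarith
    qed
    then have b: "norm b \<le> e" using w1(2) by (subst (asm) mult_le_cancel_left_pos) auto
    have a: "a = w - b" using ab by (simp add: algebra_simps)
    have H: "H w = (Gamma (l - b) * rGamma (t - l + b)) *
        (Gamma (w + (s - 2 * l)) * rGamma (w + (t - l - b))) *
        (Gamma (- w + (l + b)) * rGamma (- w + (u + 2 * l))) / (w - w0)"
    proof -
      have args: "t - l + a = w + (t - l - b)" "l - a = - w + (l + b)"
        "s - 2 * l + w = w + (s - 2 * l)" "u + 2 * l - w = - w + (u + 2 * l)"
        by (simp_all add: a)
      show ?thesis
        unfolding H_def numer_def denom_def root_prod_eq[OF ab] args Gamma_def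
        by (simp only: divide_inverse inverse_mult_distrib mult_ac)
    qed
    have n1: "norm (Gamma (l - b) * rGamma (t - l + b)) \<le> B" using B b e by auto
    have n2: "norm (Gamma (w + (s - 2 * l)) * rGamma (w + (t - l - b)))
        \<le> K * norm w powr Re ((s - 2 * l) - (t - l - b))"
    proof (rule ratio)
      show "norm (t - l - b) \<le> M" 
        using norm_triangle_ineq4[of "t - l" b] b e norm_ge_zero[of "s - 2 * l"] norm_ge_zero[of l]
          norm_ge_zero[of "u + 2 * l"] unfolding M_def by linarith
      show "Re w < 0 \<longrightarrow> (\<forall>j. norm (w + (s - 2 * l) - of_int j) \<ge> 1 / 16)"
      proof (intro impI allI)
        fix j assume "Re w < 0"
        then have "norm (w + (s - 2 * l) - of_int j) \<ge> 1 / 8" using far unfolding off_lattices_def by blast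
        then show "norm (w + (s - 2 * l) - of_int j) \<ge> 1 / 16" by linarith
      qed
    qed (use w1 in \<open>auto simp: M_def\<close>)
    have n3: "norm (Gamma (- w + (l + b)) * rGamma (- w + (u + 2 * l)))
        \<le> K * norm (- w) powr Re ((l + b) - (u + 2 * l))"
    proof (rule ratio)
      show "norm (l + b) \<le> M" 
        using norm_triangle_ineq[of l b] b e norm_ge_zero[of "s - 2 * l"] norm_ge_zero[of "t - l"]
          norm_ge_zero[of "u + 2 * l"] unfolding M_def by linarith
      show "Re (- w) < 0 \<longrightarrow> (\<forall>j. norm (- w + (l + b) - of_int j) \<ge> 1 / 16)"
      proof (intro impI allI)
        fix j assume "Re (- w) < 0"
        then have "norm (w - l - of_int (- j)) \<ge> 1 / 8"
          using far unfolding off_lattices_def uminus_complex.sel neg_less_0_iff_less by blast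
        moreover have "norm (w - l - of_int (- j)) \<le> norm (- w + (l + b) - of_int j) + norm b"
          using norm_triangle_ineq4[of b "- w + (l + b) - of_int j"] by (simp add: algebra_simps)
        ultimately show "norm (- w + (l + b) - of_int j) \<ge> 1 / 16" using b e by linarith
      qed
    qed (use w1 in \<open>auto simp: M_def\<close>)
    have n4: "norm (w - w0) \<ge> norm w / 2" using norm_triangle_ineq2[of w w0] w1 by linarith
    have "norm (H w) \<le> (B * (K * norm w powr Re ((s - 2 * l) - (t - l - b)))
       * (K * norm (- w) powr Re ((l + b) - (u + 2 * l)))) / (norm w / 2)"
      unfolding H norm_divide norm_mult[of "_ * _" "Gamma _ * rGamma _"]
      using n1 n2 n3 n4 w1 K by (intro frac_le mult_mono) (auto simp: B_def)
    also have "\<dots> = 2 * B * K * K * (norm w powr (- \<delta> + 2 * Re b) / norm w)"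
    proof -
      have "- \<delta> + 2 * Re b = Re ((s - 2 * l) - (t - l - b)) + Re ((l + b) - (u + 2 * l))"
        by (simp add: \<delta>_def)
      then have "norm w powr (- \<delta> + 2 * Re b)
        = norm w powr Re ((s - 2 * l) - (t - l - b)) * norm w powr Re ((l + b) - (u + 2 * l))"
        by (simp only: powr_add)
      then show ?thesis by (simp add: mult_ac)
    qed
    also have "norm w powr (- \<delta> + 2 * Re b) / norm w = norm w powr (- \<delta> + 2 * Re b - 1)"
      using w1 by (simp add: powr_diff)
    also have "2 * B * K * K * \<dots> \<le> 2 * B * K * K * norm w powr (- 1 - \<delta> / 2)"
      using w1 K b e complex_Re_le_cmod[of b] by (intro mult_left_mono powr_mono) (auto simp: B_def)
    finally show "norm (H w) \<le> 2 * B * K * K * norm w powr (- 1 - \<delta> / 2)" .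
  qed
qed

lemma eps_tendsto_0: "(\<lambda>k. eps x1 x2 l k) \<longlonglongrightarrow> 0"
proof -
  have "filterlim (\<lambda>k. l + of_nat k) at_infinity sequentially"
    by (rule tendsto_add_filterlim_at_infinity[OF tendsto_const tendsto_of_nat])
  then show ?thesis unfolding eps_eq by (rule tendsto_divide_0[OF tendsto_const])
qed

lemma eventually_W: "eventually (\<lambda>k. norm (eps x1 x2 l k) \<le> 1 / 16 \<and> Re (W k) \<ge> real k / 2) sequentially"
proof -
  have "eventually (\<lambda>k. norm (eps x1 x2 l k) < 1 / 16) sequentially"
    using tendstoD[OF eps_tendsto_0, of "1 / 16"] by simp
  then show ?thesis using eventually_large[of "2 * norm l + 1"]
  proof eventually_elim
    case (elim k)
    then have "Re (W k) \<ge> real k / 2"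
      using abs_Re_le_cmod[of l] abs_Re_le_cmod[of "eps x1 x2 l k"] by (simp add: W_def)
    then show ?case using elim by simp
  qed
qed

lemma eventually_V: "eventually (\<lambda>k. Re (V k) \<le> - (real k / 2)) sequentially"
  using eventually_large[of "2 * norm (2 * l - s)"]
proof eventually_elim
  case (elim k)
  then show ?case using abs_Re_le_cmod[of "2 * l - s"] by (simp add: V_def)
qed

lemma finite_poles_ball: "finite (poles \<inter> ball 0 R)"
proof -
  have "eventually (\<lambda>k. norm (W k) \<ge> R \<and> norm (V k) \<ge> R) sequentially"
    using eventually_W eventually_V eventually_large[of "2 * R"]
  proof eventually_elim
    case (elim k)
    then show ?case using abs_Re_le_cmod[of "W k"] abs_Re_le_cmod[of "V k"] by linarith
  qed
  then obtain N where N: "\<And>k. k \<ge> N \<Longrightarrow> norm (W k) \<ge> R \<and> norm (V k) \<ge> R"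
    unfolding eventually_sequentially by blast
  have "k < N" if "norm (W k) < R \<or> norm (V k) < R" for k
    using N[of k] that by (meson not_less)
  then have "poles \<inter> ball 0 R \<subseteq> insert w0 (W ` {..<N} \<union> V ` {..<N})"
    by (auto simp: poles_def)
  then show ?thesis by (rule finite_subset) auto
qed

text \<open>
For large \<open>k\<close> the poles \<open>W k\<close> and \<open>V k\<close> lie within \<open>1 / 16\<close> of lattice points. Consequently a contour that satisfies \<open>off_lattices\<close> and is far from the origin avoids all poles.
\<close>
lemma large_poles_not_off_lattices: obtains R where "\<And>w. w \<in> poles \<Longrightarrow> norm w \<ge> R \<Longrightarrow> \<not> off_lattices w"
proof -
  obtain N where N: "\<And>k. k \<ge> N \<Longrightarrow> norm (eps x1 x2 l k) \<le> 1 / 16 \<and> Re (W k) \<ge> real k / 2 \<and> Re (V k) \<le> - (real k / 2) \<and> real k \<ge> 1"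
    using eventually_conj[OF eventually_W eventually_conj[OF eventually_V eventually_large[of 1]]]
    unfolding eventually_sequentially by auto
  have "bounded (insert w0 (W ` {..<N} \<union> V ` {..<N}))" by (intro finite_imp_bounded) auto
  then obtain B where B: "\<And>w. w \<in> insert w0 (W ` {..<N} \<union> V ` {..<N}) \<Longrightarrow> norm w \<le> B"
    unfolding bounded_iff by blast
  show ?thesis
  proof
    fix w assume w: "w \<in> poles" "norm w \<ge> B + 1"
    then have "w \<notin> insert w0 (W ` {..<N} \<union> V ` {..<N})" using B[of w] by auto
    then have w': "w \<notin> W ` {..<N}" "w \<notin> V ` {..<N}" "w \<in> range W \<or> w \<in> range V"
      using w(1) by (auto simp: poles_def)
    have "k \<ge> N" if "w = W k \<or> w = V k" for k
      using w'(1,2) that by (cases "k < N") auto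
    then consider k where "w = W k" "k \<ge> N" | k where "w = V k" "k \<ge> N"
      using w'(3) by blast
    then show "\<not> off_lattices w"
    proof cases
      case 1
      then have "Re w > 0" "norm (w - l - of_int (int k)) \<le> 1 / 16"
        using N[of k] by (auto simp: W_def)
      then have "\<not> norm (w - l - of_int (int k)) \<ge> 1 / 8" by linarith
      then show ?thesis using \<open>Re w > 0\<close> unfolding off_lattices_def by blast
    next
      case 2
      then have "Re w < 0" "norm (w + (s - 2 * l) - of_int (- int k)) = 0"
        using N[of k] by (auto simp: V_def)
      then have "\<not> norm (w + (s - 2 * l) - of_int (- int k)) \<ge> 1 / 8" by linarith
      then show ?thesis using \<open>Re w < 0\<close> unfolding off_lattices_def by blast
    qed
  qed
qed

section \<open>Absolute convergence of the series of residues\<close>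
text \<open>
The residue at \<open>q k\<close> is an integral over the circle of radius \<open>1 / 4\<close>, where \<open>\<bar>w\<bar> \<ge> k / 4\<close> and the decay of \<open>H\<close>
gives the summable bound \<open>k\<^sup>-\<^sup>1\<^sup>-\<^sup>\<delta>\<^sup>/\<^sup>2\<close>.
\<close>
lemma summable_residues:
  assumes q: "eventually (\<lambda>k. norm (q k) \<ge> real k / 2) sequentially"
    and circle: "eventually (\<lambda>k. \<forall>w. dist (q k) w = 1 / 4 \<longrightarrow> off_lattices w) sequentially"
    and isolated: "eventually (\<lambda>k. \<forall>p\<in>poles. p \<noteq> q k \<longrightarrow> dist (q k) p \<ge> 1 / 2) sequentially"
  shows "summable (\<lambda>k. norm (residue H (q k)))"
proof -
  obtain K R where K: "K \<ge> 0"
    "\<And>w. norm w \<ge> R \<Longrightarrow> off_lattices w \<Longrightarrow> norm (H w) \<le> K * norm w powr (- 1 - \<delta> / 2)"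
    using norm_H_le by blast
  have "eventually (\<lambda>k. norm (norm (residue H (q k))) \<le> K * 4 powr (1 + \<delta> / 2) * real k powr (- 1 - \<delta> / 2)) sequentially"
    using q circle isolated eventually_large[of "max 1 (4 * R)"]
  proof eventually_elim
    case (elim k)
    have bd: "norm (H w) \<le> K * (real k / 4) powr (- 1 - \<delta> / 2)" if w: "dist (q k) w = 1 / 4" for w
    proof -
      have "norm w \<ge> real k / 4"
        using elim(1,4) w norm_triangle_ineq2[of "q k" "q k - w"] by (simp add: dist_norm)
      moreover from this have "norm (H w) \<le> K * norm w powr (- 1 - \<delta> / 2)"
        using elim(2,4) w by (intro K) auto
      moreover have "norm w powr (- 1 - \<delta> / 2) \<le> (real k / 4) powr (- 1 - \<delta> / 2)"
        using calculation(1) elim(4) delta_pos by (intro powr_mono2') auto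
      ultimately show ?thesis using K(1) by (meson mult_left_mono order_trans)
    qed
    have "norm (residue H (q k)) \<le> K * (real k / 4) powr (- 1 - \<delta> / 2) * (1 / 4)"
    proof (rule norm_residue_le[of "1 / 4" "1 / 2"])
      show "H holomorphic_on ball (q k) (1 / 2) - {q k}"
        using elim(3) by (intro holomorphic_on_subset[OF holomorphic_H]) (auto simp: not_less[symmetric])
    qed (use bd K in auto)
    also have "\<dots> \<le> K * (real k / 4) powr (- 1 - \<delta> / 2)" using K by simp
    also have "(real k / 4) powr (- 1 - \<delta> / 2) = 4 powr (1 + \<delta> / 2) * real k powr (- 1 - \<delta> / 2)"
    proof -
      have "- 1 - \<delta> / 2 = - (1 + \<delta> / 2)" by simp
      then show ?thesis by (simp only: powr_divide powr_minus) (simp add: field_simps)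
    qed
    finally show ?case by (simp add: mult_ac)
  qed
  moreover have "summable (\<lambda>k. K * 4 powr (1 + \<delta> / 2) * real k powr (- 1 - \<delta> / 2))"
    using delta_pos by (intro summable_mult) (simp add: summable_real_powr_iff)
  ultimately show ?thesis by (rule summable_comparison_test_ev)
qed

lemma eps_bounded: obtains B where "B > 0" "\<And>k. norm (eps x1 x2 l k) \<le> B"
  using BseqE[OF convergent_imp_Bseq[OF convergentI[OF eps_tendsto_0]]] by blast

lemma summable_residues_W: "summable (\<lambda>k. norm (residue H (W k)))"
proof (rule summable_residues)
  show "eventually (\<lambda>k. norm (W k) \<ge> real k / 2) sequentially"
    using eventually_W
  proof eventually_elim
    case (elim k)
    then show ?case using complex_Re_le_cmod[of "W k"] by linarith
  qed
  show "eventually (\<lambda>k. \<forall>w. dist (W k) w = 1 / 4 \<longrightarrow> off_lattices w) sequentially"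
    using eventually_W eventually_large[of 1]
  proof eventually_elim
    case (elim k)
    show ?case
    proof (intro allI impI)
      fix w assume w: "dist (W k) w = 1 / 4"
      have "\<bar>Re (W k - w)\<bar> \<le> 1 / 4" using abs_Re_le_cmod[of "W k - w"] w by (simp add: dist_norm)
      then have "\<bar>Re (W k) - Re w\<bar> \<le> 1 / 4" by simp
      then have "Re w > 0" using elim by linarith
      moreover have "norm (w - l - of_int j) \<ge> 1 / 8" for j
      proof (cases "j = int k")
        case True
        have "W k - w = eps x1 x2 l k - (w - l - of_int j)" by (simp add: W_def True)
        then have "dist (W k) w \<le> norm (eps x1 x2 l k) + norm (w - l - of_int j)"
          unfolding dist_norm by (simp only: norm_triangle_ineq4)
        then show ?thesis using elim w by linarith
      next
        case False
        have eq: "of_int j - of_int (int k) = eps x1 x2 l k - (W k - w) - (w - l - of_int j)" by (simp add: W_def)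
        have "1 \<le> norm (eps x1 x2 l k) + norm (W k - w) + norm (w - l - of_int j)"
          using norm_int_diff_ge_1[OF False, unfolded eq] norm_triangle_ineq4[of "eps x1 x2 l k - (W k - w)" "w - l - of_int j"]
            norm_triangle_ineq4[of "eps x1 x2 l k" "W k - w"] by linarith
        then show ?thesis using elim w by (simp add: dist_norm)
      qed
      ultimately show "off_lattices w" by (simp add: off_lattices_def)
    qed
  qed
  obtain B where B: "B > 0" "\<And>k. norm (eps x1 x2 l k) \<le> B" using eps_bounded by blast
  show "eventually (\<lambda>k. \<forall>p\<in>poles. p \<noteq> W k \<longrightarrow> dist (W k) p \<ge> 1 / 2) sequentially"
    using eventually_W eventually_large[of "2 * norm w0 + 2 * norm (2 * l - s) + 2"] eventually_large[of "2 * B + norm l"]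
  proof eventually_elim
    case (elim k)
    have dist_ge: "dist (W k) p \<ge> 1 / 2" if "Re p \<le> norm w0 + norm (2 * l - s)" for p
      using that elim(1,2) complex_Re_le_cmod[of "W k - p"] by (simp add: dist_norm)
    have W: "dist (W k) (W j) \<ge> 1 / 2" if "j \<noteq> k" for j
    proof -
      have lk: "norm (l + of_nat k) \<ge> 2 * B"
        using elim(3) norm_triangle_ineq4[of "l + of_nat k" l] by simp
      have "norm (eps x1 x2 l j / (l + of_nat k)) \<le> B / (2 * B)"
        unfolding norm_divide using lk B by (intro frac_le) auto
      also have "\<dots> = 1 / 2" using B by simp
      finally have "norm (1 - eps x1 x2 l j / (l + of_nat k)) \<ge> 1 / 2"
        using norm_triangle_ineq2[of 1 "eps x1 x2 l j / (l + of_nat k)"] by simp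
      moreover have "norm (of_nat j - of_nat k :: complex) \<ge> 1"
        using norm_int_diff_ge_1[of "int j" "int k"] that by simp
      ultimately have "1 * (1 / 2) \<le> norm (W j - W k)"
        unfolding W_diff norm_mult by (intro mult_mono) auto
      then show ?thesis by (simp add: dist_norm norm_minus_commute)
    qed
    show ?case
    proof (intro ballI impI)
      fix p assume p: "p \<in> poles" "p \<noteq> W k"
      then consider "p = w0" | j where "p = V j" | j where "p = W j" "j \<noteq> k" by (auto simp: poles_def)
      then show "dist (W k) p \<ge> 1 / 2"
      proof cases
        case 1
        then show ?thesis using complex_Re_le_cmod[of w0] by (intro dist_ge) (simp add: add_increasing2)
      next
        case (2 j)
        then have "Re p \<le> norm (2 * l - s)" using complex_Re_le_cmod[of "2 * l - s"] by (simp add: V_def)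
        then show ?thesis by (intro dist_ge) (simp add: add_increasing)
      qed (use W in auto)
    qed
  qed
qed

lemma summable_residues_V: "summable (\<lambda>k. norm (residue H (V k)))"
proof (rule summable_residues)
  show "eventually (\<lambda>k. norm (V k) \<ge> real k / 2) sequentially"
    using eventually_V
  proof eventually_elim
    case (elim k)
    then show ?case using abs_Re_le_cmod[of "V k"] by linarith
  qed
  show "eventually (\<lambda>k. \<forall>w. dist (V k) w = 1 / 4 \<longrightarrow> off_lattices w) sequentially"
    using eventually_V eventually_large[of 1]
  proof eventually_elim
    case (elim k)
    show ?case
    proof (intro allI impI)
      fix w assume w: "dist (V k) w = 1 / 4"
      have "\<bar>Re (V k - w)\<bar> \<le> 1 / 4" using abs_Re_le_cmod[of "V k - w"] w by (simp add: dist_norm)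
      then have "\<bar>Re (V k) - Re w\<bar> \<le> 1 / 4" by simp
      then have "Re w < 0" using elim by linarith
      moreover have "norm (w + (s - 2 * l) - of_int j) \<ge> 1 / 8" for j
      proof (cases "j = - int k")
        case True
        have "w - V k = w + (s - 2 * l) - of_int j" by (simp add: V_def True)
        then have "dist (V k) w = norm (w + (s - 2 * l) - of_int j)"
          unfolding dist_norm norm_minus_commute[of "V k"] by (simp only:)
        then show ?thesis using w by linarith
      next
        case False
        have eq: "of_int j - of_int (- int k) = (w - V k) - (w + (s - 2 * l) - of_int j)" by (simp add: V_def)
        have "1 \<le> norm (w - V k) + norm (w + (s - 2 * l) - of_int j)"
          using norm_int_diff_ge_1[OF False, unfolded eq] norm_triangle_ineq4[of "w - V k" "w + (s - 2 * l) - of_int j"] by linarith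
        then show ?thesis using w by (simp add: dist_norm norm_minus_commute)
      qed
      ultimately show "off_lattices w" by (simp add: off_lattices_def)
    qed
  qed
  obtain B where B: "B > 0" "\<And>k. norm (eps x1 x2 l k) \<le> B" using eps_bounded by blast
  show "eventually (\<lambda>k. \<forall>p\<in>poles. p \<noteq> V k \<longrightarrow> dist (V k) p \<ge> 1 / 2) sequentially"
    using eventually_V eventually_large[of "2 * norm w0 + 2 * norm l + 2 * B + 2"]
  proof eventually_elim
    case (elim k)
    have dist_ge: "dist (V k) p \<ge> 1 / 2" if "Re p \<ge> - norm w0 - (norm l + B)" for p
      using that elim(1,2) abs_Re_le_cmod[of "V k - p"] by (simp add: dist_norm)
    show ?case
    proof (intro ballI impI)
      fix p assume p: "p \<in> poles" "p \<noteq> V k"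
      then consider "p = w0" | j where "p = V j" "j \<noteq> k" | j where "p = W j" by (auto simp: poles_def)
      then show "dist (V k) p \<ge> 1 / 2"
      proof cases
        case 1
        have "Re w0 \<ge> - norm w0 - (norm l + B)"
          using abs_Re_le_cmod[of w0] B(1) norm_ge_zero[of l] by linarith
        then show ?thesis unfolding 1 by (rule dist_ge)
      next
        case (2 j)
        have "V k - V j = of_int (int j) - of_int (int k)" by (simp add: V_def)
        then show ?thesis using 2 norm_int_diff_ge_1[of "int j" "int k"] by (simp add: dist_norm)
      next
        case (3 j)
        have "Re p \<ge> - (norm l + B)"
          using abs_Re_le_cmod[of l] abs_Re_le_cmod[of "eps x1 x2 l j"] B(2)[of j] by (simp add: 3 W_def)
        then show ?thesis using norm_ge_zero[of w0] by (intro dist_ge) linarith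
      qed
    qed
  qed
qed

section \<open>Summation of the residues over growing rectangles\<close>
text \<open>
The vertical sides of the rectangle run half-way between neighbouring points of the lattices
\<open>2\<lambda> - s + \<int>\<close> (left) and \<open>\<lambda> + \<int>\<close> (right).
\<close>
definition lower_left where "lower_left n = Complex (Re (2 * l - s) - real n - 1 / 2) (- real n)"
definition upper_right where "upper_right n = Complex (Re l + real n + 1 / 2) (real n)"

lemma eventually_rectangle:
  "eventually (\<lambda>n. \<forall>w \<in> path_image (rectpath (lower_left n) (upper_right n)). norm w \<ge> real n / 2 \<and> off_lattices w) sequentially"
  using eventually_large[of "2 * norm l + 2 * norm (2 * l - s) + 2"]
proof eventually_elim
  case (elim n)
  have re: "\<bar>Re l\<bar> \<le> norm l" "\<bar>Re (2 * l - s)\<bar> \<le> norm (2 * l - s)"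
    "\<bar>Im l\<bar> \<le> norm l" "\<bar>Im (2 * l - s)\<bar> \<le> norm (2 * l - s)"
    using abs_Re_le_cmod abs_Im_le_cmod by blast+
  have le: "Re (lower_left n) \<le> Re (upper_right n)" "Im (lower_left n) \<le> Im (upper_right n)"
    using elim re unfolding lower_left_def upper_right_def by auto
  show ?case
  proof
    fix w assume "w \<in> path_image (rectpath (lower_left n) (upper_right n))"
    then consider "Re w = Re (2 * l - s) - real n - 1 / 2" | "Re w = Re l + real n + 1 / 2"
      | "\<bar>Im w\<bar> = real n"
      unfolding path_image_rectpath[OF le] by (auto simp: lower_left_def upper_right_def)
    then show "norm w \<ge> real n / 2 \<and> off_lattices w"
    proof cases
      case 1
      then have neg: "Re w < 0" "\<bar>Re w\<bar> \<ge> real n / 2" using elim re by linarith+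
      have "norm (w + (s - 2 * l) - of_int j) \<ge> 1 / 8" for j
      proof -
        have "Re (w + (s - 2 * l) - of_int j) = - (real_of_int (int n + j) + 1 / 2)" using 1 by simp
        then show ?thesis using abs_of_int_plus_half_ge[of "int n + j"]
          abs_Re_le_cmod[of "w + (s - 2 * l) - of_int j"] by linarith
      qed
      then show ?thesis using neg abs_Re_le_cmod[of w] by (simp add: off_lattices_def)
    next
      case 2
      then have pos: "Re w > 0" "\<bar>Re w\<bar> \<ge> real n / 2" using elim re by linarith+
      have "norm (w - l - of_int j) \<ge> 1 / 8" for j
      proof -
        have "Re (w - l - of_int j) = real_of_int (int n - j) + 1 / 2" using 2 by simp
        then show ?thesis using abs_of_int_plus_half_ge[of "int n - j"]
          abs_Re_le_cmod[of "w - l - of_int j"] by linarith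
      qed
      then show ?thesis using pos abs_Re_le_cmod[of w] by (simp add: off_lattices_def)
    next
      case 3
      have "norm (w - l - of_int j) \<ge> 1 / 8" for j
        using abs_Im_le_cmod[of "w - l - of_int j"] 3 elim re by simp
      moreover have "norm (w + (s - 2 * l) - of_int j) \<ge> 1 / 8" for j
        using abs_Im_le_cmod[of "w + (s - 2 * l) - of_int j"] 3 elim re by simp
      moreover have "norm w \<ge> real n / 2" using abs_Im_le_cmod[of w] 3 by simp
      ultimately show ?thesis by (simp add: off_lattices_def)
    qed
  qed
qed

text \<open>
The perimeter of the \<open>n\<close>-th rectangle is \<open>O(n)\<close> and \<open>H\<close> is \<open>O(n\<^sup>-\<^sup>1\<^sup>-\<^sup>\<delta>\<^sup>/\<^sup>2)\<close> on it.
\<close>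
lemma sum_residues_tendsto_0:
  "(\<lambda>n. \<Sum>p\<in>poles \<inter> box (lower_left n) (upper_right n). residue H p) \<longlonglongrightarrow> 0"
proof -
  obtain K R where K: "K \<ge> 0"
    "\<And>w. norm w \<ge> R \<Longrightarrow> off_lattices w \<Longrightarrow> norm (H w) \<le> K * norm w powr (- 1 - \<delta> / 2)"
    using norm_H_le by blast
  obtain R' where R': "\<And>w. w \<in> poles \<Longrightarrow> norm w \<ge> R' \<Longrightarrow> \<not> off_lattices w"
    using large_poles_not_off_lattices by blast
  let ?S = "\<lambda>n. \<Sum>p\<in>poles \<inter> box (lower_left n) (upper_right n). residue H p"
  have "eventually (\<lambda>n. norm (2 * pi * \<i> * ?S n) \<le> 20 * K * (real n / 2) powr (- (\<delta> / 2))) sequentially"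
    using eventually_rectangle eventually_conj[OF eventually_large[of "2 * R"] eventually_large[of "2 * R'"]] eventually_large[of "2 * norm l + 2 * norm (2 * l - s) + 2"]
  proof eventually_elim
    case (elim n)
    have re: "\<bar>Re l\<bar> \<le> norm l" "\<bar>Re (2 * l - s)\<bar> \<le> norm (2 * l - s)"
      using abs_Re_le_cmod by blast+
    have n0: "real n > 0" using elim(3) norm_ge_zero[of l] norm_ge_zero[of "2 * l - s"] by linarith
    have "norm (2 * pi * \<i> * ?S n) \<le> (K * (real n / 2) powr (- 1 - \<delta> / 2)) *
        (2 * ((Re (upper_right n) - Re (lower_left n)) + (Im (upper_right n) - Im (lower_left n))))"
    proof (rule norm_sum_residues_rectangle_le[OF finite_poles_ball holomorphic_H])
      show "Re (lower_left n) < Re (upper_right n)" "Im (lower_left n) < Im (upper_right n)"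
        using elim(3) re n0 unfolding lower_left_def upper_right_def by auto
      fix w assume "w \<in> path_image (rectpath (lower_left n) (upper_right n))"
      then have w: "norm w \<ge> real n / 2" "off_lattices w" using elim(1) by auto
      have "w \<notin> poles" using R'[of w] w elim(2) by auto
      moreover have "norm (H w) \<le> K * norm w powr (- 1 - \<delta> / 2)" using w elim(2) by (intro K) auto
      moreover have "norm w powr (- 1 - \<delta> / 2) \<le> (real n / 2) powr (- 1 - \<delta> / 2)"
        using w n0 delta_pos by (intro powr_mono2') auto
      ultimately show "w \<notin> poles \<and> norm (H w) \<le> K * (real n / 2) powr (- 1 - \<delta> / 2)"
        using K(1) by (meson mult_left_mono order_trans)
    qed (use K in auto)
    also have "\<dots> \<le> (K * (real n / 2) powr (- 1 - \<delta> / 2)) * (10 * real n)"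
      using elim(3) re K by (intro mult_left_mono) (auto simp: lower_left_def upper_right_def)
    also have "\<dots> = 20 * K * ((real n / 2) powr (- 1 - \<delta> / 2) * (real n / 2) powr 1)"
    proof -
      have "(real n / 2) powr 1 = real n / 2" using n0 by simp
      then show ?thesis by simp
    qed
    also have "\<dots> = 20 * K * (real n / 2) powr (- (\<delta> / 2))"
      by (subst powr_add[symmetric]) simp
    finally show ?case .
  qed
  moreover have "(\<lambda>n. 20 * K * (real n / 2) powr (- (\<delta> / 2))) \<longlonglongrightarrow> 20 * K * 0"
    proof (intro tendsto_mult tendsto_const tendsto_neg_powr)
    show "filterlim (\<lambda>n. real n / 2) at_top sequentially"
      using filterlim_tendsto_pos_mult_at_top[OF tendsto_const[of "1 / 2"] _ filterlim_real_sequentially]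
      by simp
  qed (use delta_pos in auto)
  then have "(\<lambda>n. 20 * K * (real n / 2) powr (- (\<delta> / 2))) \<longlonglongrightarrow> 0" by simp
  ultimately have "(\<lambda>n. 2 * pi * \<i> * ?S n) \<longlonglongrightarrow> 0" by (rule Lim_null_comparison)
  from tendsto_mult[OF tendsto_const[of "1 / (2 * pi * \<i>)"] this] show ?thesis by simp
qed

lemma eventually_in_box: "eventually (\<lambda>n. p \<in> box (lower_left n) (upper_right n)) sequentially"
  using eventually_large[of "norm l + norm (2 * l - s) + norm p + 1"]
proof eventually_elim
  case (elim n)
  have "\<bar>Re l\<bar> \<le> norm l" "\<bar>Re (2 * l - s)\<bar> \<le> norm (2 * l - s)" "\<bar>Re p\<bar> \<le> norm p" "\<bar>Im p\<bar> \<le> norm p"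
    using abs_Re_le_cmod abs_Im_le_cmod by blast+
  then show ?case using elim norm_ge_zero[of l] norm_ge_zero[of "2 * l - s"]
    by (auto simp: in_box_complex_iff lower_left_def upper_right_def)
qed

lemma sum_residues_zero:
  "residue H w0 + (\<Sum>k. residue H (W k)) + (\<Sum>k. residue H (V k)) = 0"
proof -
  let ?Q = "\<lambda>n. box (lower_left n) (upper_right n)"
  let ?A = "\<lambda>n. {k. W k \<in> ?Q n}" and ?B = "\<lambda>n. {k. V k \<in> ?Q n}"
  have fin: "finite (poles \<inter> ?Q n)" for n
  proof -
    obtain R where "?Q n \<subseteq> ball 0 R" using bounded_subset_ballD[OF bounded_box] by blast
    then show ?thesis using finite_subset[OF _ finite_poles_ball[of R]] by blast
  qed
  have finA: "finite (?A n)" for n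
  proof (rule inj_on_finite[OF _ _ fin[of n]])
    show "inj_on W (?A n)" using inj_W by (rule inj_on_subset) auto
  qed (auto simp: poles_def)
  have finB: "finite (?B n)" for n
  proof (rule inj_on_finite[OF _ _ fin[of n]])
    show "inj_on V (?B n)" using inj_V by (rule inj_on_subset) auto
  qed (auto simp: poles_def)
  have "(\<lambda>n. residue H w0 + (\<Sum>k\<in>?A n. residue H (W k)) + (\<Sum>k\<in>?B n. residue H (V k)))
    \<longlonglongrightarrow> residue H w0 + (\<Sum>k. residue H (W k)) + (\<Sum>k. residue H (V k))"
    using eventually_in_box
    by (intro tendsto_add tendsto_const tendsto_sum_exhausting summable_residues_W summable_residues_V finA finB) auto
  moreover have "eventually (\<lambda>n. (\<Sum>p\<in>poles \<inter> ?Q n. residue H p)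
    = residue H w0 + (\<Sum>k\<in>?A n. residue H (W k)) + (\<Sum>k\<in>?B n. residue H (V k))) sequentially"
    using eventually_in_box[of w0]
  proof eventually_elim
    case (elim n)
    have poles: "poles \<inter> ?Q n = insert w0 (W ` ?A n \<union> V ` ?B n)"
      using elim by (auto simp: poles_def)
    have "w0 \<notin> W ` ?A n \<union> V ` ?B n"
      using W_ne_w0[symmetric] V_ne_w0[symmetric] by blast
    moreover have "W ` ?A n \<inter> V ` ?B n = {}" using W_ne_V by blast
    moreover have "finite (W ` ?A n)" "finite (V ` ?B n)" using finA finB by blast+
    ultimately have "(\<Sum>p\<in>poles \<inter> ?Q n. residue H p)
      = residue H w0 + ((\<Sum>p\<in>W ` ?A n. residue H p) + (\<Sum>p\<in>V ` ?B n. residue H p))"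
      unfolding poles by (simp only: sum.insert sum.union_disjoint finite_UnI not_False_eq_True)
    moreover have "(\<Sum>p\<in>W ` ?A n. residue H p) = (\<Sum>k\<in>?A n. residue H (W k))"
      using sum.reindex[OF inj_on_subset[OF inj_W subset_UNIV]] by (simp only: o_def)
    moreover have "(\<Sum>p\<in>V ` ?B n. residue H p) = (\<Sum>k\<in>?B n. residue H (V k))"
      using sum.reindex[OF inj_on_subset[OF inj_V subset_UNIV]] by (simp only: o_def)
    ultimately show ?case by (simp only: add.assoc)
  qed
  ultimately have "(\<lambda>n. \<Sum>p\<in>poles \<inter> ?Q n. residue H p)
    \<longlonglongrightarrow> residue H w0 + (\<Sum>k. residue H (W k)) + (\<Sum>k. residue H (V k))"
    by (simp add: tendsto_cong)
  then show ?thesis using sum_residues_tendsto_0 LIMSEQ_unique by blast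
qed

lemma expansion:
  "summable (term1 x1 x2 s t u l) \<and> summable (term2 x1 x2 s t u l) \<and>
    Gamma x1 * Gamma x2 * Gamma (s - x1 - x2)
      * (rGamma (t - x1) * rGamma (t - x2) * rGamma (u + x1 + x2))
    = (\<Sum>k. term1 x1 x2 s t u l k) + (\<Sum>k. term2 x1 x2 s t u l k)"
proof -
  have s1: "summable (term1 x1 x2 s t u l)"
    using summable_residues_W unfolding residue_W norm_minus_cancel by (rule summable_norm_cancel)
  have s2: "summable (term2 x1 x2 s t u l)"
    using summable_residues_V unfolding residue_V norm_minus_cancel by (rule summable_norm_cancel)
  from sum_residues_zero show ?thesis
    unfolding residue_W residue_V residue_w0 suminf_minus[OF s1] suminf_minus[OF s2] using s1 s2
    by (simp add: algebra_simps)
qed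

end

theorem corollary4p1:
  fixes x1 x2 s t u l :: complex
  assumes "Re (2 * l - s + t + u) > 0"
    and "x1 \<notin> \<int>\<^sub>\<le>\<^sub>0" "x2 \<notin> \<int>\<^sub>\<le>\<^sub>0" "s - x1 - x2 \<notin> \<int>\<^sub>\<le>\<^sub>0" "l \<notin> \<int>\<^sub>\<le>\<^sub>0"
    and "\<And>k. l - eps x1 x2 l k \<notin> \<int>\<^sub>\<le>\<^sub>0"
    and "\<And>k. s - l + eps x1 x2 l k + of_nat k \<notin> \<int>\<^sub>\<le>\<^sub>0"
    and "\<And>k. c_plus x1 x2 s l k \<notin> \<int>\<^sub>\<le>\<^sub>0"
    and "\<And>k. c_minus x1 x2 s l k \<notin> \<int>\<^sub>\<le>\<^sub>0"
  shows "summable (term1 x1 x2 s t u l) \<and> summable (term2 x1 x2 s t u l) \<and>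
    Gamma x1 * Gamma x2 * Gamma (s - x1 - x2)
      * (rGamma (t - x1) * rGamma (t - x2) * rGamma (u + x1 + x2))
    = (\<Sum>k. term1 x1 x2 s t u l k) + (\<Sum>k. term2 x1 x2 s t u l k)"
proof -
  interpret gamma_curve x1 x2 s t u l
    using assms by unfold_locales
  show ?thesis by (rule expansion)
qed

end
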